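(* Any $3$-cosymplectic manifold $M$ admits an almost cosymplectic sphere of cosymplectic structures which is both taut and round; that is, an almost cosymplectic sphere $\{(\eta_\lambda,\Omega_\lambda)\}_{\lambda\in\mathbb{S}^2}$ on $M$, both taut and round, such that $(\eta_\lambda,\Omega_\lambda)$ is a cosymplectic structure for every $\lambda\in\mathbb{S}^2$.
   Context: An almost contact structure on $M$ is a triple $(\phi,\xi,\eta)$ of a $(1,1)$-tensor field, a vector field and a $1$-form with $\phi^2=-I+\eta\otimes\xi$ and $\eta(\xi)=1$. A Riemannian metric $g$ is compatible if $g(\phi X,\phi Y)=g(X,Y)-\eta(X)\eta(Y)$; then $(\phi,\xi,\eta,g)$ is an almost contact metric structure, with fundamental $2$-form $\Omega(X,Y)=g(X,\phi Y)$. It is normal if $\phi^2[X,Y]+[\phi X,\phi Y]-\phi[\phi X,Y]-\phi[X,\phi Y]+\big(X(\eta(Y))-Y(\eta(X))-\eta([X,Y])\big)\xi=0$ for all vector fields $X,Y$. An almost contact metric $3$-structure is a triple of almost contact structures $(\phi_\alpha,\xi_\alpha,\eta_\alpha)$, $\alpha=1,2,3$, with a Riemannian metric $g$ compatible with each of them, such that for every even permutation $(\alpha,\beta,\gamma)$ of $\{1,2,3\}$: $\phi_\gamma=\phi_\alpha\phi_\beta-\eta_\beta\otimes\xi_\alpha=-\phi_\beta\phi_\alpha+\eta_\alpha\otimes\xi_\beta$, $\xi_\gamma=\phi_\alpha\xi_\beta=-\phi_\beta\xi_\alpha$, $\eta_\gamma=\eta_\alpha\circ\phi_\beta=-\eta_\beta\circ\phi_\alpha$.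 A $3$-cosymplectic manifold is a manifold with an almost contact metric $3$-structure such that each $(\phi_\alpha,\xi_\alpha,\eta_\alpha,g)$ is normal with $d\eta_\alpha=0$ and $d\Omega_\alpha=0$, where $\Omega_\alpha=g(\cdot,\phi_\alpha\cdot)$. An almost cosymplectic structure on a $(2m+1)$-dimensional manifold is a pair $(\eta,\Omega)$ of a $1$-form and a $2$-form with $\eta\wedge\Omega^m$ a volume form; it is a cosymplectic structure if $d\eta=0$ and $d\Omega=0$. Its Reeb vector field $\xi$ is the unique vector field with $i_\xi\eta=1$, $i_\xi\Omega=0$. Three almost cosymplectic structures $(\eta_i,\Omega_i)$ with Reeb vector fields $\xi_i$, $i=1,2,3$, generate an almost cosymplectic sphere if $(\eta_\lambda,\Omega_\lambda):=(\sum_i\lambda_i\eta_i,\sum_i\lambda_i\Omega_i)$ is almost cosymplectic for every $\lambda\in\mathbb{S}^2$. It is taut if $\eta_\lambda\wedge\Omega_\lambda^m$ is independent of $\lambda\in\mathbb{S}^2$, and round if $\sum_i\lambda_i\xi_i$ is the Reeb vector field of $(\eta_\lambda,\Omega_\lambda)$ for every $\lambda\in\mathbb{S}^2$. *)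

theory Defs
  imports "HOL-Analysis.Analysis" "HOL-Library.Function_Algebras"
begin

text \<open>Functions into a real vector space form a real vector space pointwise. Tangent vectors,
  vector fields and tensor fields below are such functions, so their sums and real multiples
  are the usual ones.\<close>

instantiation "fun" :: (type, scaleR) scaleR
begin
definition scaleR_fun :: "real \<Rightarrow> ('a \<Rightarrow> 'b) \<Rightarrow> 'a \<Rightarrow> 'b"
  where "scaleR_fun r f = (\<lambda>x. r *\<^sub>R f x)"
instance ..
end

instance "fun" :: (type, real_vector) real_vector
  by standard (auto simp: scaleR_fun_def plus_fun_def fun_eq_iff scaleR_right_distrib
      scaleR_left_distrib)

section \<open>Smooth manifolds\<close>

text \<open>On an open set \<open>S\<close>, this is the class of \<open>k\<close> times continuously differentiable maps.\<close>

primrec Ck_on :: "nat \<Rightarrow> 'e::euclidean_space set \<Rightarrow> ('e \<Rightarrow> 'f::real_normed_vector) \<Rightarrow> bool" where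
  "Ck_on 0 S f \<longleftrightarrow> continuous_on S f"
| "Ck_on (Suc k) S f \<longleftrightarrow> (\<forall>x\<in>S. f differentiable at x) \<and>
     (\<forall>v. Ck_on k S (\<lambda>x. frechet_derivative f (at x) v))"

definition smooth_on :: "'e::euclidean_space set \<Rightarrow> ('e \<Rightarrow> 'f::real_normed_vector) \<Rightarrow> bool"
  where "smooth_on S f \<longleftrightarrow> (\<forall>k. Ck_on k S f)"

text \<open>A chart is a pair of a domain and a coordinate map, whose values off the domain are
  irrelevant.\<close>

type_synonym ('a, 'e) chart = "'a set \<times> ('a \<Rightarrow> 'e)"

abbreviation chart_dom :: "('a, 'e) chart \<Rightarrow> 'a set" where "chart_dom \<equiv> fst"

abbreviation coords :: "('a, 'e) chart \<Rightarrow> 'a \<Rightarrow> 'e" where "coords \<equiv> snd"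

definition chart_img :: "('a, 'e) chart \<Rightarrow> 'e set"
  where "chart_img c = coords c ` chart_dom c"

definition chart_inv :: "('a, 'e) chart \<Rightarrow> 'e \<Rightarrow> 'a"
  where "chart_inv c = inv_into (chart_dom c) (coords c)"

definition transition :: "('a, 'e) chart \<Rightarrow> ('a, 'e) chart \<Rightarrow> 'e \<Rightarrow> 'e"
  where "transition c c' = coords c' \<circ> chart_inv c"

definition is_chart :: "'a topology \<Rightarrow> ('a, 'e::euclidean_space) chart \<Rightarrow> bool"
  where "is_chart X c \<longleftrightarrow> openin X (chart_dom c) \<and> open (chart_img c) \<and>
    homeomorphic_map (subtopology X (chart_dom c)) (top_of_set (chart_img c)) (coords c)"

record ('a, 'e) manifold =
  mtop :: "'a topology"
  atlas :: "('a, 'e) chart set"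

abbreviation pts :: "('a, 'e) manifold \<Rightarrow> 'a set" where "pts M \<equiv> topspace (mtop M)"

text \<open>A manifold of dimension \<open>DIM('e)\<close>. The atlas need not be maximal. Manifolds are
  nonempty, so that the dimension is well defined.\<close>

definition smooth_manifold :: "('a, 'e::euclidean_space) manifold \<Rightarrow> bool"
  where "smooth_manifold M \<longleftrightarrow>
    pts M \<noteq> {} \<and> Hausdorff_space (mtop M) \<and> second_countable (mtop M) \<and>
    (\<forall>c\<in>atlas M. is_chart (mtop M) c) \<and>
    (\<Union>c\<in>atlas M. chart_dom c) = pts M \<and>
    (\<forall>c\<in>atlas M. \<forall>c'\<in>atlas M.
       smooth_on (coords c ` (chart_dom c \<inter> chart_dom c')) (transition c c'))"

definition charts_at :: "('a, 'e) manifold \<Rightarrow> 'a \<Rightarrow> ('a, 'e) chart set"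
  where "charts_at M p = {c \<in> atlas M. p \<in> chart_dom c}"

section \<open>Tangent vectors and vector fields\<close>

text \<open>A tangent vector at \<open>p\<close> assigns to each chart around \<open>p\<close> its coordinate representation in
  that chart, these being related by the derivatives of the transition maps. It is given the
  value \<open>0\<close> on charts that are not around \<open>p\<close>, so that equality of tangent vectors is equality
  of functions.\<close>

type_synonym ('a, 'e) tvec = "('a, 'e) chart \<Rightarrow> 'e"

definition tangent_space :: "('a, 'e::euclidean_space) manifold \<Rightarrow> 'a \<Rightarrow> ('a, 'e) tvec set"
  where "tangent_space M p = {v.
    (\<forall>c\<in>charts_at M p. \<forall>c'\<in>charts_at M p.
       v c' = frechet_derivative (transition c c') (at (coords c p)) (v c)) \<and>
    (\<forall>c. c \<notin> charts_at M p \<longrightarrow> v c = 0)}"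

text \<open>The tangent vector at \<open>p\<close> whose representation in the chart \<open>c\<close> is \<open>u\<close>. For fixed \<open>c\<close>
  and \<open>u\<close> these are the coordinate vector fields of \<open>c\<close>.\<close>

definition coord_vec :: "('a, 'e::euclidean_space) manifold \<Rightarrow> ('a, 'e) chart \<Rightarrow> 'e \<Rightarrow> 'a
    \<Rightarrow> ('a, 'e) tvec"
  where "coord_vec M c u p = (\<lambda>c'. if c' \<in> charts_at M p
    then frechet_derivative (transition c c') (at (coords c p)) u else 0)"

type_synonym ('a, 'e) vfield = "'a \<Rightarrow> ('a, 'e) tvec"

text \<open>Smooth vector fields, extended by zero off the manifold.\<close>

definition vector_field :: "('a, 'e::euclidean_space) manifold \<Rightarrow> ('a, 'e) vfield \<Rightarrow> bool"
  where "vector_field M X \<longleftrightarrow>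
    (\<forall>p\<in>pts M. X p \<in> tangent_space M p) \<and> (\<forall>p. p \<notin> pts M \<longrightarrow> X p = 0) \<and>
    (\<forall>c\<in>atlas M. smooth_on (chart_img c) (\<lambda>x. X (chart_inv c x) c))"

text \<open>\<open>X(f)\<close> at \<open>p\<close>, computed in an arbitrary chart around \<open>p\<close>; by the chain rule the choice
  is irrelevant.\<close>

definition vderiv :: "('a, 'e::euclidean_space) manifold \<Rightarrow> ('a, 'e) vfield \<Rightarrow> ('a \<Rightarrow> real)
    \<Rightarrow> 'a \<Rightarrow> real"
  where "vderiv M X f p = (let c = (SOME c. c \<in> charts_at M p) in
    frechet_derivative (f \<circ> chart_inv c) (at (coords c p)) (X p c))"

definition lie_bracket :: "('a, 'e::euclidean_space) manifold \<Rightarrow> ('a, 'e) vfield \<Rightarrow> ('a, 'e) vfield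
    \<Rightarrow> ('a, 'e) vfield"
  where "lie_bracket M X Y p = (\<lambda>c. if c \<in> charts_at M p
    then frechet_derivative (\<lambda>x. Y (chart_inv c x) c) (at (coords c p)) (X p c)
       - frechet_derivative (\<lambda>x. X (chart_inv c x) c) (at (coords c p)) (Y p c)
    else 0)"

section \<open>Tensor fields\<close>

text \<open>Tensor fields are constrained only at points of the manifold and on tangent vectors there;
  their other values are irrelevant. They are smooth if their components in each chart are.\<close>

definition tlinear :: "('a, 'e::euclidean_space) manifold \<Rightarrow> 'a
    \<Rightarrow> (('a, 'e) tvec \<Rightarrow> 'b::real_vector) \<Rightarrow> bool"
  where "tlinear M p f \<longleftrightarrow> (\<forall>v\<in>tangent_space M p. \<forall>w\<in>tangent_space M p. \<forall>a b.
    f (a *\<^sub>R v + b *\<^sub>R w) = a *\<^sub>R f v + b *\<^sub>R f w)"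

definition tbilinear :: "('a, 'e::euclidean_space) manifold \<Rightarrow> 'a
    \<Rightarrow> (('a, 'e) tvec \<Rightarrow> ('a, 'e) tvec \<Rightarrow> real) \<Rightarrow> bool"
  where "tbilinear M p f \<longleftrightarrow>
    (\<forall>u\<in>tangent_space M p. tlinear M p (f u) \<and> tlinear M p (\<lambda>v. f v u))"

type_synonym ('a, 'e) form1 = "'a \<Rightarrow> ('a, 'e) tvec \<Rightarrow> real"
type_synonym ('a, 'e) tensor02 = "'a \<Rightarrow> ('a, 'e) tvec \<Rightarrow> ('a, 'e) tvec \<Rightarrow> real"
type_synonym ('a, 'e) tensor11 = "'a \<Rightarrow> ('a, 'e) tvec \<Rightarrow> ('a, 'e) tvec"

definition one_form :: "('a, 'e::euclidean_space) manifold \<Rightarrow> ('a, 'e) form1 \<Rightarrow> bool"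
  where "one_form M \<eta> \<longleftrightarrow> (\<forall>p\<in>pts M. tlinear M p (\<eta> p)) \<and>
    (\<forall>c\<in>atlas M. \<forall>u. smooth_on (chart_img c)
       (\<lambda>x. \<eta> (chart_inv c x) (coord_vec M c u (chart_inv c x))))"

definition tensor02_field :: "('a, 'e::euclidean_space) manifold \<Rightarrow> ('a, 'e) tensor02 \<Rightarrow> bool"
  where "tensor02_field M B \<longleftrightarrow> (\<forall>p\<in>pts M. tbilinear M p (B p)) \<and>
    (\<forall>c\<in>atlas M. \<forall>u w. smooth_on (chart_img c)
       (\<lambda>x. B (chart_inv c x) (coord_vec M c u (chart_inv c x)) (coord_vec M c w (chart_inv c x))))"

definition tensor11_field :: "('a, 'e::euclidean_space) manifold \<Rightarrow> ('a, 'e) tensor11 \<Rightarrow> bool"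
  where "tensor11_field M \<phi> \<longleftrightarrow>
    (\<forall>p\<in>pts M. \<phi> p ` tangent_space M p \<subseteq> tangent_space M p \<and> tlinear M p (\<phi> p)) \<and>
    (\<forall>c\<in>atlas M. \<forall>u. smooth_on (chart_img c)
       (\<lambda>x. \<phi> (chart_inv c x) (coord_vec M c u (chart_inv c x)) c))"

definition two_form :: "('a, 'e::euclidean_space) manifold \<Rightarrow> ('a, 'e) tensor02 \<Rightarrow> bool"
  where "two_form M \<Omega> \<longleftrightarrow> tensor02_field M \<Omega> \<and>
    (\<forall>p\<in>pts M. \<forall>v\<in>tangent_space M p. \<Omega> p v v = 0)"

definition riemannian_metric :: "('a, 'e::euclidean_space) manifold \<Rightarrow> ('a, 'e) tensor02 \<Rightarrow> bool"
  where "riemannian_metric M g \<longleftrightarrow> tensor02_field M g \<and>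
    (\<forall>p\<in>pts M. \<forall>v\<in>tangent_space M p. \<forall>w\<in>tangent_space M p. g p v w = g p w v) \<and>
    (\<forall>p\<in>pts M. \<forall>v\<in>tangent_space M p. v \<noteq> 0 \<longrightarrow> g p v v > 0)"

definition capply1 :: "('a, 'e) form1 \<Rightarrow> ('a, 'e) vfield \<Rightarrow> 'a \<Rightarrow> real"
  where "capply1 \<eta> X = (\<lambda>p. \<eta> p (X p))"

definition capply2 :: "('a, 'e) tensor02 \<Rightarrow> ('a, 'e) vfield \<Rightarrow> ('a, 'e) vfield \<Rightarrow> 'a \<Rightarrow> real"
  where "capply2 \<Omega> X Y = (\<lambda>p. \<Omega> p (X p) (Y p))"

definition tapply :: "('a, 'e) tensor11 \<Rightarrow> ('a, 'e) vfield \<Rightarrow> ('a, 'e) vfield"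
  where "tapply \<phi> X = (\<lambda>p. \<phi> p (X p))"

text \<open>Exterior derivatives, by the invariant formula on vector fields. The numerical factor
  that some authors put in front plays no role for closedness.\<close>

definition ext_deriv1 :: "('a, 'e::euclidean_space) manifold \<Rightarrow> ('a, 'e) form1
    \<Rightarrow> ('a, 'e) vfield \<Rightarrow> ('a, 'e) vfield \<Rightarrow> 'a \<Rightarrow> real"
  where "ext_deriv1 M \<eta> X Y p =
    vderiv M X (capply1 \<eta> Y) p - vderiv M Y (capply1 \<eta> X) p - \<eta> p (lie_bracket M X Y p)"

definition ext_deriv2 :: "('a, 'e::euclidean_space) manifold \<Rightarrow> ('a, 'e) tensor02
    \<Rightarrow> ('a, 'e) vfield \<Rightarrow> ('a, 'e) vfield \<Rightarrow> ('a, 'e) vfield \<Rightarrow> 'a \<Rightarrow> real"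
  where "ext_deriv2 M \<Omega> X Y Z p =
    vderiv M X (capply2 \<Omega> Y Z) p + vderiv M Y (capply2 \<Omega> Z X) p + vderiv M Z (capply2 \<Omega> X Y) p
    - \<Omega> p (lie_bracket M X Y p) (Z p) - \<Omega> p (lie_bracket M Y Z p) (X p)
    - \<Omega> p (lie_bracket M Z X p) (Y p)"

definition closed1 :: "('a, 'e::euclidean_space) manifold \<Rightarrow> ('a, 'e) form1 \<Rightarrow> bool"
  where "closed1 M \<eta> \<longleftrightarrow> (\<forall>X Y. vector_field M X \<longrightarrow> vector_field M Y \<longrightarrow>
    (\<forall>p\<in>pts M. ext_deriv1 M \<eta> X Y p = 0))"

definition closed2 :: "('a, 'e::euclidean_space) manifold \<Rightarrow> ('a, 'e) tensor02 \<Rightarrow> bool"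
  where "closed2 M \<Omega> \<longleftrightarrow>
    (\<forall>X Y Z. vector_field M X \<longrightarrow> vector_field M Y \<longrightarrow> vector_field M Z \<longrightarrow>
      (\<forall>p\<in>pts M. ext_deriv2 M \<Omega> X Y Z p = 0))"

section \<open>Exterior products\<close>

text \<open>An alternating \<open>k\<close>-form on a vector space is encoded as a function of a sequence of vectors
  that looks only at the entries \<open>0, \<dots>, k-1\<close>.\<close>

definition wedge :: "nat \<Rightarrow> nat \<Rightarrow> ((nat \<Rightarrow> 'v) \<Rightarrow> real) \<Rightarrow> ((nat \<Rightarrow> 'v) \<Rightarrow> real)
    \<Rightarrow> (nat \<Rightarrow> 'v) \<Rightarrow> real"
  where "wedge k l \<alpha> \<beta> v = (\<Sum>\<sigma> | \<sigma> permutes {..<k + l}.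
    of_int (sign \<sigma>) * \<alpha> (\<lambda>i. v (\<sigma> i)) * \<beta> (\<lambda>i. v (\<sigma> (k + i)))) / (fact k * fact l)"

primrec wedge_power2 :: "('v \<Rightarrow> 'v \<Rightarrow> real) \<Rightarrow> nat \<Rightarrow> (nat \<Rightarrow> 'v) \<Rightarrow> real" where
  "wedge_power2 \<omega> 0 = (\<lambda>v. 1)"
| "wedge_power2 \<omega> (Suc m) = wedge 2 (2 * m) (\<lambda>v. \<omega> (v 0) (v 1)) (wedge_power2 \<omega> m)"

text \<open>The \<open>(2m+1)\<close>-form \<open>\<eta> \<and> \<Omega>\<^sup>m\<close> at the point \<open>p\<close>.\<close>

definition eta_wedge_Omega :: "nat \<Rightarrow> ('a, 'e) form1 \<Rightarrow> ('a, 'e) tensor02 \<Rightarrow> 'a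
    \<Rightarrow> (nat \<Rightarrow> ('a, 'e) tvec) \<Rightarrow> real"
  where "eta_wedge_Omega m \<eta> \<Omega> p = wedge 1 (2 * m) (\<lambda>v. \<eta> p (v 0)) (wedge_power2 (\<Omega> p) m)"

section \<open>3-cosymplectic manifolds\<close>

definition almost_contact :: "('a, 'e::euclidean_space) manifold \<Rightarrow> ('a, 'e) tensor11
    \<Rightarrow> ('a, 'e) vfield \<Rightarrow> ('a, 'e) form1 \<Rightarrow> bool"
  where "almost_contact M \<phi> \<xi> \<eta> \<longleftrightarrow>
    tensor11_field M \<phi> \<and> vector_field M \<xi> \<and> one_form M \<eta> \<and>
    (\<forall>p\<in>pts M. \<forall>v\<in>tangent_space M p. \<phi> p (\<phi> p v) = - v + \<eta> p v *\<^sub>R \<xi> p) \<and>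
    (\<forall>p\<in>pts M. \<eta> p (\<xi> p) = 1)"

definition compatible_metric :: "('a, 'e::euclidean_space) manifold \<Rightarrow> ('a, 'e) tensor11
    \<Rightarrow> ('a, 'e) form1 \<Rightarrow> ('a, 'e) tensor02 \<Rightarrow> bool"
  where "compatible_metric M \<phi> \<eta> g \<longleftrightarrow>
    (\<forall>p\<in>pts M. \<forall>v\<in>tangent_space M p. \<forall>w\<in>tangent_space M p.
       g p (\<phi> p v) (\<phi> p w) = g p v w - \<eta> p v * \<eta> p w)"

definition fundamental_form :: "('a, 'e) tensor11 \<Rightarrow> ('a, 'e) tensor02 \<Rightarrow> ('a, 'e) tensor02"
  where "fundamental_form \<phi> g = (\<lambda>p v w. g p v (\<phi> p w))"

definition normal_structure :: "('a, 'e::euclidean_space) manifold \<Rightarrow> ('a, 'e) tensor11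
    \<Rightarrow> ('a, 'e) vfield \<Rightarrow> ('a, 'e) form1 \<Rightarrow> bool"
  where "normal_structure M \<phi> \<xi> \<eta> \<longleftrightarrow>
    (\<forall>X Y. vector_field M X \<longrightarrow> vector_field M Y \<longrightarrow> (\<forall>p\<in>pts M.
       \<phi> p (\<phi> p (lie_bracket M X Y p)) + lie_bracket M (tapply \<phi> X) (tapply \<phi> Y) p
       - \<phi> p (lie_bracket M (tapply \<phi> X) Y p) - \<phi> p (lie_bracket M X (tapply \<phi> Y) p)
       + (vderiv M X (capply1 \<eta> Y) p - vderiv M Y (capply1 \<eta> X) p
          - \<eta> p (lie_bracket M X Y p)) *\<^sub>R \<xi> p = 0))"

text \<open>The index set \<open>{1,2,3}\<close> is the type \<open>3\<close>; the quantifier below ranges over the even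
  permutations \<open>(\<alpha>,\<beta>,\<gamma>)\<close> of it.\<close>

definition almost_contact_metric_3 :: "('a, 'e::euclidean_space) manifold \<Rightarrow> (3 \<Rightarrow> ('a, 'e) tensor11)
    \<Rightarrow> (3 \<Rightarrow> ('a, 'e) vfield) \<Rightarrow> (3 \<Rightarrow> ('a, 'e) form1) \<Rightarrow> ('a, 'e) tensor02 \<Rightarrow> bool"
  where "almost_contact_metric_3 M \<phi> \<xi> \<eta> g \<longleftrightarrow>
    riemannian_metric M g \<and>
    (\<forall>\<alpha>. almost_contact M (\<phi> \<alpha>) (\<xi> \<alpha>) (\<eta> \<alpha>) \<and> compatible_metric M (\<phi> \<alpha>) (\<eta> \<alpha>) g) \<and>
    (\<forall>(\<alpha>, \<beta>, \<gamma>) \<in> {(1, 2, 3), (2, 3, 1), (3, 1, 2)}. \<forall>p\<in>pts M.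
       (\<forall>v\<in>tangent_space M p.
          \<phi> \<gamma> p v = \<phi> \<alpha> p (\<phi> \<beta> p v) - \<eta> \<beta> p v *\<^sub>R \<xi> \<alpha> p \<and>
          \<phi> \<gamma> p v = - \<phi> \<beta> p (\<phi> \<alpha> p v) + \<eta> \<alpha> p v *\<^sub>R \<xi> \<beta> p \<and>
          \<eta> \<gamma> p v = \<eta> \<alpha> p (\<phi> \<beta> p v) \<and> \<eta> \<gamma> p v = - \<eta> \<beta> p (\<phi> \<alpha> p v)) \<and>
       \<xi> \<gamma> p = \<phi> \<alpha> p (\<xi> \<beta> p) \<and> \<xi> \<gamma> p = - \<phi> \<beta> p (\<xi> \<alpha> p))"

definition three_cosymplectic :: "('a, 'e::euclidean_space) manifold \<Rightarrow> (3 \<Rightarrow> ('a, 'e) tensor11)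
    \<Rightarrow> (3 \<Rightarrow> ('a, 'e) vfield) \<Rightarrow> (3 \<Rightarrow> ('a, 'e) form1) \<Rightarrow> ('a, 'e) tensor02 \<Rightarrow> bool"
  where "three_cosymplectic M \<phi> \<xi> \<eta> g \<longleftrightarrow>
    smooth_manifold M \<and> almost_contact_metric_3 M \<phi> \<xi> \<eta> g \<and>
    (\<forall>\<alpha>. normal_structure M (\<phi> \<alpha>) (\<xi> \<alpha>) (\<eta> \<alpha>) \<and> closed1 M (\<eta> \<alpha>) \<and>
       closed2 M (fundamental_form (\<phi> \<alpha>) g))"

section \<open>Almost cosymplectic spheres\<close>

definition almost_cosymplectic :: "nat \<Rightarrow> ('a, 'e::euclidean_space) manifold \<Rightarrow> ('a, 'e) form1
    \<Rightarrow> ('a, 'e) tensor02 \<Rightarrow> bool"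
  where "almost_cosymplectic m M \<eta> \<Omega> \<longleftrightarrow>
    smooth_manifold M \<and> DIM('e) = 2 * m + 1 \<and> one_form M \<eta> \<and> two_form M \<Omega> \<and>
    (\<forall>p\<in>pts M. \<exists>v. (\<forall>i. v i \<in> tangent_space M p) \<and> eta_wedge_Omega m \<eta> \<Omega> p v \<noteq> 0)"

definition cosymplectic :: "nat \<Rightarrow> ('a, 'e::euclidean_space) manifold \<Rightarrow> ('a, 'e) form1
    \<Rightarrow> ('a, 'e) tensor02 \<Rightarrow> bool"
  where "cosymplectic m M \<eta> \<Omega> \<longleftrightarrow>
    almost_cosymplectic m M \<eta> \<Omega> \<and> closed1 M \<eta> \<and> closed2 M \<Omega>"

definition reeb_conditions :: "('a, 'e::euclidean_space) manifold \<Rightarrow> ('a, 'e) form1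
    \<Rightarrow> ('a, 'e) tensor02 \<Rightarrow> ('a, 'e) vfield \<Rightarrow> bool"
  where "reeb_conditions M \<eta> \<Omega> \<xi> \<longleftrightarrow> vector_field M \<xi> \<and>
    (\<forall>p\<in>pts M. \<eta> p (\<xi> p) = 1 \<and> (\<forall>v\<in>tangent_space M p. \<Omega> p (\<xi> p) v = 0))"

definition is_reeb :: "('a, 'e::euclidean_space) manifold \<Rightarrow> ('a, 'e) form1
    \<Rightarrow> ('a, 'e) tensor02 \<Rightarrow> ('a, 'e) vfield \<Rightarrow> bool"
  where "is_reeb M \<eta> \<Omega> \<xi> \<longleftrightarrow>
    reeb_conditions M \<eta> \<Omega> \<xi> \<and> (\<forall>\<zeta>. reeb_conditions M \<eta> \<Omega> \<zeta> \<longrightarrow> \<zeta> = \<xi>)"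

text \<open>\<open>\<Sum>\<^sub>i \<lambda>\<^sub>i F\<^sub>i\<close>, for a triple \<open>F\<close> of vector or tensor fields; \<open>\<lambda>\<close> is reserved for abstraction,
  so points of the sphere are called \<open>l\<close>.\<close>

definition comb :: "real ^ 3 \<Rightarrow> (3 \<Rightarrow> 'b::real_vector) \<Rightarrow> 'b"
  where "comb l F = (\<Sum>i\<in>UNIV. (l $ i) *\<^sub>R F i)"

abbreviation S2 :: "(real ^ 3) set" where "S2 \<equiv> sphere 0 1"

definition almost_cosymplectic_sphere :: "nat \<Rightarrow> ('a, 'e::euclidean_space) manifold
    \<Rightarrow> (3 \<Rightarrow> ('a, 'e) form1) \<Rightarrow> (3 \<Rightarrow> ('a, 'e) tensor02) \<Rightarrow> bool"
  where "almost_cosymplectic_sphere m M \<eta> \<Omega> \<longleftrightarrow>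
    (\<forall>i. almost_cosymplectic m M (\<eta> i) (\<Omega> i)) \<and>
    (\<forall>l\<in>S2. almost_cosymplectic m M (comb l \<eta>) (comb l \<Omega>))"

definition taut :: "nat \<Rightarrow> ('a, 'e::euclidean_space) manifold
    \<Rightarrow> (3 \<Rightarrow> ('a, 'e) form1) \<Rightarrow> (3 \<Rightarrow> ('a, 'e) tensor02) \<Rightarrow> bool"
  where "taut m M \<eta> \<Omega> \<longleftrightarrow>
    (\<forall>l\<in>S2. \<forall>l'\<in>S2. \<forall>p\<in>pts M. \<forall>v. (\<forall>i. v i \<in> tangent_space M p) \<longrightarrow>
       eta_wedge_Omega m (comb l \<eta>) (comb l \<Omega>) p v
     = eta_wedge_Omega m (comb l' \<eta>) (comb l' \<Omega>) p v)"

definition round_sphere :: "('a, 'e::euclidean_space) manifold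
    \<Rightarrow> (3 \<Rightarrow> ('a, 'e) form1) \<Rightarrow> (3 \<Rightarrow> ('a, 'e) tensor02) \<Rightarrow> bool"
  where "round_sphere M \<eta> \<Omega> \<longleftrightarrow>
    (\<exists>\<xi>. (\<forall>i. is_reeb M (\<eta> i) (\<Omega> i) (\<xi> i)) \<and>
      (\<forall>l\<in>S2. is_reeb M (comb l \<eta>) (comb l \<Omega>) (comb l \<xi>)))"

end

(*
  Take the given eta_i and the fundamental forms Omega_i = g(., phi_i .). For l in S^2 the
  combinations phi_l, xi_l, eta_l again form an almost contact metric structure with metric g and
  fundamental form Omega_l, because phi_l phi_u = -<l,u> + phi_{l x u} + eta_u (x) xi_l. An adapted
  basis xi_l, phi_l u_1, u_1, ..., phi_l u_m, u_m shows that the dimension is 2m+1 and that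
  F_l = eta_l /\ Omega_l^m does not vanish, and Omega_l = g(., phi_l .) determines xi_l as the Reeb
  field, which is roundness. Closedness is linear in the forms.

  For tautness, any l, l' in S^2 are exchanged by a half turn of R^3, and this half turn is
  induced by a linear map T of the tangent space: F_l o T = F_l' and F_l' o T = F_l. Since top forms
  are proportional, F_l' = c F_l, whence F_l = c^2 F_l and c^2 = 1. So on a fixed tuple the
  square of F_l, and by connectedness of S^2 also F_l itself, does not depend on l.
*)

theory Submission
  imports Defs "HOL-Combinatorics.Permutations"
begin

section \<open>Alternating multilinear forms\<close>

text \<open>On the common kernel of the three \<open>\<eta> \<alpha>\<close> the operators
  \<open>\<Phi> l\<close> multiply like imaginary quaternions, but on the span of the three Reeb
  vectors \<open>\<Phi> l\<close> is the cross product with \<open>l\<close>, which has a kernel. So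
  \<open>\<Phi> n\<close> can induce a rotation of the indices only on the horizontal part; on the
  vertical part the rotation itself has to be put in. Half turns are chosen among all rotations
  because their quaternion is purely imaginary, hence realised by \<open>\<Phi> n\<close>, and
  because one of them exchanges \<open>l\<close> and \<open>l'\<close>. The exchange gives c^2 = 1
  without computing any determinant, and continuity in \<open>l\<close> replaces a comparison of the
  orientations of adapted bases belonging to different \<open>l\<close>.

  Tensor fields are constrained only on tangent spaces, which are subsets of a function type. The
  linear algebra is therefore done on the model type \<open>'e\<close> and carried to each tangent
  space by a chart.\<close>

definition multilinear_form :: "nat \<Rightarrow> ((nat \<Rightarrow> 'v::real_vector) \<Rightarrow> real) \<Rightarrow> bool"
  where "multilinear_form k G \<longleftrightarrow>
    (\<forall>v w. (\<forall>i<k. v i = w i) \<longrightarrow> G v = G w) \<and> (\<forall>v. \<forall>i<k. linear (\<lambda>x. G (v(i := x))))"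

definition alternating_form :: "nat \<Rightarrow> ((nat \<Rightarrow> 'v) \<Rightarrow> real) \<Rightarrow> bool"
  where "alternating_form k G \<longleftrightarrow>
    (\<forall>v \<sigma>. \<sigma> permutes {..<k} \<longrightarrow> G (\<lambda>i. v (\<sigma> i)) = of_int (sign \<sigma>) * G v)"

lemma multilinear_formD_cong:
  "multilinear_form k G \<Longrightarrow> (\<And>i. i < k \<Longrightarrow> v i = w i) \<Longrightarrow> G v = G w"
  unfolding multilinear_form_def by blast

lemma multilinear_formD_linear:
  "multilinear_form k G \<Longrightarrow> i < k \<Longrightarrow> linear (\<lambda>x. G (v(i := x)))"
  unfolding multilinear_form_def by blast

lemma alternating_formD:
  "alternating_form k G \<Longrightarrow> \<sigma> permutes {..<k} \<Longrightarrow> G (\<lambda>i. v (\<sigma> i)) = of_int (sign \<sigma>) * G v"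
  unfolding alternating_form_def by blast

text \<open>The sum over all permutations antisymmetrises by itself: permuting the arguments by
  \<tau> replaces \<sigma> by \<tau> \<circ> \<sigma>, which only reindexes the sum and changes each
  sign by that of \<tau>.\<close>

lemma alternating_form_wedge: "alternating_form (k + l) (wedge k l \<alpha> \<beta>)"
  unfolding alternating_form_def
proof (intro allI impI)
  fix v :: "nat \<Rightarrow> 'a" and \<tau> :: "nat \<Rightarrow> nat"
  assume \<tau>: "\<tau> permutes {..<k + l}"
  let ?P = "{\<sigma>. \<sigma> permutes {..<k + l}}"
  let ?f = "\<lambda>\<sigma>. of_int (sign \<sigma>) * \<alpha> (\<lambda>i. v (\<sigma> i)) * \<beta> (\<lambda>i. v (\<sigma> (k + i)))"
  have "(\<Sum>\<sigma>\<in>?P. ?f \<sigma>) = (\<Sum>\<sigma>\<in>?P. ?f (\<tau> \<circ> \<sigma>))"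
    by (rule setum_permutations_compose_left[OF \<tau>])
  also have "\<dots> = (\<Sum>\<sigma>\<in>?P. of_int (sign \<tau>) * (of_int (sign \<sigma>) *
      \<alpha> (\<lambda>i. v (\<tau> (\<sigma> i))) * \<beta> (\<lambda>i. v (\<tau> (\<sigma> (k + i))))))"
  proof (rule sum.cong[OF refl])
    fix \<sigma> assume "\<sigma> \<in> ?P"
    then have "sign (\<tau> \<circ> \<sigma>) = sign \<tau> * sign \<sigma>"
      using \<tau> by (auto intro!: sign_compose permutation_permutes[THEN iffD2])
    then show "?f (\<tau> \<circ> \<sigma>) = of_int (sign \<tau>) * (of_int (sign \<sigma>) *
      \<alpha> (\<lambda>i. v (\<tau> (\<sigma> i))) * \<beta> (\<lambda>i. v (\<tau> (\<sigma> (k + i)))))" by simp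
  qed
  finally have *: "(\<Sum>\<sigma>\<in>?P. ?f \<sigma>) = of_int (sign \<tau>) * (\<Sum>\<sigma>\<in>?P. of_int (sign \<sigma>) *
      \<alpha> (\<lambda>i. v (\<tau> (\<sigma> i))) * \<beta> (\<lambda>i. v (\<tau> (\<sigma> (k + i)))))"
    by (simp add: sum_distrib_left)
  have "of_int (sign \<tau>) * of_int (sign \<tau>) = (1::real)"
    by (metis of_int_1 of_int_mult sign_idempotent)
  then show "wedge k l \<alpha> \<beta> (\<lambda>i. v (\<tau> i)) = of_int (sign \<tau>) * wedge k l \<alpha> \<beta> v"
    unfolding wedge_def * by (simp add: mult.assoc[symmetric])
qed

lemma linear_mult_const_right: "linear f \<Longrightarrow> linear (\<lambda>x. c * f x * (d::real))"
  for f :: "'v::real_vector \<Rightarrow> real"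
  by (simp add: linear_iff algebra_simps)

text \<open>In each summand the varied argument \<open>i\<close> occurs exactly once, at position
  \<open>inv \<sigma> i\<close>. One factor is linear in it and the other does not see it.\<close>

lemma multilinear_form_wedge:
  assumes \<alpha>: "multilinear_form k \<alpha>" and \<beta>: "multilinear_form l \<beta>"
  shows "multilinear_form (k + l) (wedge k l \<alpha> \<beta>)"
  unfolding multilinear_form_def
proof (intro conjI allI impI)
  fix v w :: "nat \<Rightarrow> 'a" assume eq: "\<forall>i<k + l. v i = w i"
  have "\<alpha> (\<lambda>i. v (\<sigma> i)) = \<alpha> (\<lambda>i. w (\<sigma> i))" "\<beta> (\<lambda>i. v (\<sigma> (k + i))) = \<beta> (\<lambda>i. w (\<sigma> (k + i)))"
    if "\<sigma> permutes {..<k + l}" for \<sigma>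
  proof -
    have "v (\<sigma> i) = w (\<sigma> i)" if "i < k + l" for i
      using permutes_in_image[OF \<open>\<sigma> permutes _\<close>, of i] that eq by simp
    then show "\<alpha> (\<lambda>i. v (\<sigma> i)) = \<alpha> (\<lambda>i. w (\<sigma> i))" "\<beta> (\<lambda>i. v (\<sigma> (k + i))) = \<beta> (\<lambda>i. w (\<sigma> (k + i)))"
      by (auto intro!: multilinear_formD_cong[OF \<alpha>] multilinear_formD_cong[OF \<beta>])
  qed
  then show "wedge k l \<alpha> \<beta> v = wedge k l \<alpha> \<beta> w" by (simp add: wedge_def)
next
  fix v :: "nat \<Rightarrow> 'a" and i assume i: "i < k + l"
  have "linear (\<lambda>x. of_int (sign \<sigma>) * \<alpha> (\<lambda>j. (v(i := x)) (\<sigma> j)) * \<beta> (\<lambda>j. (v(i := x)) (\<sigma> (k + j))))"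
    if \<sigma>: "\<sigma> permutes {..<k + l}" for \<sigma>
  proof -
    define r where "r = inv \<sigma> i"
    have r: "\<sigma> r = i" "r < k + l"
      using permutes_inverses(1)[OF \<sigma>] permutes_in_image[OF permutes_inv[OF \<sigma>], of i] i
      by (auto simp: r_def)
    have upd: "(v(i := x)) (\<sigma> j) = (if j = r then x else v (\<sigma> j))" for x j
      using r permutes_inj[OF \<sigma>] by (auto dest: injD)
    show ?thesis
    proof (cases "r < k")
      case True
      have "\<beta> (\<lambda>j. (v(i := x)) (\<sigma> (k + j))) = \<beta> (\<lambda>j. v (\<sigma> (k + j)))" for x
        using True by (intro multilinear_formD_cong[OF \<beta>]) (simp only: upd, simp)
      moreover have "(\<lambda>j. (v(i := x)) (\<sigma> j)) = (\<lambda>j. v (\<sigma> j))(r := x)" for x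
        by (rule ext) (simp only: upd, simp)
      ultimately show ?thesis
        using multilinear_formD_linear[OF \<alpha> True, of "\<lambda>j. v (\<sigma> j)"]
        by (simp only: linear_mult_const_right)
    next
      case False
      have "\<alpha> (\<lambda>j. (v(i := x)) (\<sigma> j)) = \<alpha> (\<lambda>j. v (\<sigma> j))" for x
        using False by (intro multilinear_formD_cong[OF \<alpha>]) (simp only: upd, simp)
      moreover have "(\<lambda>j. (v(i := x)) (\<sigma> (k + j))) = (\<lambda>j. v (\<sigma> (k + j)))(r - k := x)" for x
        using False by (intro ext) (simp only: upd, auto)
      moreover have "r - k < l" using False r(2) by simp
      ultimately show ?thesis
        using multilinear_formD_linear[OF \<beta>, of "r - k" "\<lambda>j. v (\<sigma> (k + j))"]
          linear_mult_const_right[of _ _ 1]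
        by (simp only:) simp
    qed
  qed
  then have "linear (\<lambda>x. \<Sum>\<sigma> | \<sigma> permutes {..<k + l}. of_int (sign \<sigma>) *
      \<alpha> (\<lambda>j. (v(i := x)) (\<sigma> j)) * \<beta> (\<lambda>j. (v(i := x)) (\<sigma> (k + j))))"
    by (intro linear_compose_sum) auto
  from linear_mult_const_right[OF this, of 1 "1 / (fact k * fact l)"]
  show "linear (\<lambda>x. wedge k l \<alpha> \<beta> (v(i := x)))"
    unfolding wedge_def by simp
qed

lemma alternating_form_wedge_power2: "alternating_form (2 * m) (wedge_power2 \<omega> m)"
proof (cases m)
  case 0
  then show ?thesis by (simp add: alternating_form_def)
next
  case (Suc n)
  then show ?thesis using alternating_form_wedge[of 2 "2 * n"] by simp
qed

lemma multilinear_form_bilinear: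
  assumes "bilinear \<omega>" shows "multilinear_form 2 (\<lambda>v. \<omega> (v 0) (v 1))"
  unfolding multilinear_form_def
proof (intro conjI allI impI)
  fix v :: "nat \<Rightarrow> 'a" and i :: nat assume "i < 2"
  then have "i = 0 \<or> i = 1" by auto
  then show "linear (\<lambda>x. \<omega> ((v(i := x)) 0) ((v(i := x)) 1))"
    using assms by (auto simp: bilinear_def)
qed simp

lemma multilinear_form_wedge_power2:
  assumes "bilinear \<omega>" shows "multilinear_form (2 * m) (wedge_power2 \<omega> m)"
proof (induction m)
  case 0
  then show ?case by (simp add: multilinear_form_def)
next
  case (Suc m)
  then show ?case
    using multilinear_form_wedge[OF multilinear_form_bilinear[OF assms] Suc] by simp
qed

text \<open>Pullback commutes with wedge powers. It is applied twice: to the map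
  \<open>turn n\<close>, and to the identification of a tangent space with its coordinate
  space.\<close>

lemma wedge_power2_pullback:
  "wedge_power2 \<omega> m (\<lambda>i. f (v i)) = wedge_power2 (\<lambda>x y. \<omega> (f x) (f y)) m v"
proof (induction m arbitrary: v)
  case (Suc m)
  then show ?case by (simp add: wedge_def)
qed simp

section \<open>Top forms on a vector space are proportional\<close>

lemma alternating_form_eq_0:
  assumes "alternating_form k G" "i < k" "j < k" "i \<noteq> j" "v i = v j"
  shows "G v = 0"
proof -
  have "Transposition.transpose i j permutes {..<k}" using assms by (intro permutes_swap_id) auto
  from alternating_formD[OF assms(1) this, of v]
  have "G (\<lambda>l. v (Transposition.transpose i j l)) = - G v" using assms(4) by (simp add: sign_swap_id)
  moreover have "(\<lambda>l. v (Transposition.transpose i j l)) = v" using assms(5) by (auto simp: Transposition.transpose_def)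
  ultimately show ?thesis by simp
qed

lemma linear_eq_0_span:
  assumes "linear f" "\<And>x. x \<in> B \<Longrightarrow> f x = 0" "span B = UNIV"
  shows "f x = 0"
  using linear_eq_0_on_span[OF assms(1,2), of B x] assms(3) by auto

text \<open>The arguments are freed one at a time. If all of them are taken from \<open>b\<close>,
  they either repeat, so that \<open>G\<close> vanishes, or permute \<open>b\<close>, so that
  \<open>G v\<close> is \<open>G b\<close> up to sign. An argument already known to be harmless on
  \<open>b\<close> is harmless everywhere by linearity.\<close>

lemma alternating_top_form_eq_0:
  assumes ml: "multilinear_form k G" and alt: "alternating_form k G"
    and span: "span (b ` {..<k}) = UNIV" and G0: "G b = 0"
  shows "G v = 0"
proof -
  have "G v = 0" if "n \<le> k" "\<And>i. n \<le> i \<Longrightarrow> i < k \<Longrightarrow> v i \<in> b ` {..<k}" for n v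
    using that
  proof (induction n arbitrary: v)
    case 0
    then have "\<forall>i. \<exists>j. i < k \<longrightarrow> j < k \<and> v i = b j" by fastforce
    then obtain \<sigma> where \<sigma>: "\<And>i. i < k \<Longrightarrow> \<sigma> i < k \<and> v i = b (\<sigma> i)" by metis
    \<comment> \<open>The choice function \<sigma> is arbitrary from \<open>k\<close> on, whereas a
      permutation of \<open>{..<k}\<close> must be the identity there.\<close>
    define \<tau> where "\<tau> i = (if i < k then \<sigma> i else i)" for i
    show ?case
    proof (cases "inj_on \<tau> {..<k}")
      case True
      have "\<tau> ` {..<k} \<subseteq> {..<k}" using \<sigma> by (auto simp: \<tau>_def)
      then have "bij_betw \<tau> {..<k} {..<k}"
        using True by (simp add: bij_betw_def endo_inj_surj)
      then have "\<tau> permutes {..<k}"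
        by (rule bij_imp_permutes) (simp add: \<tau>_def)
      from alternating_formD[OF alt this, of b]
      have "G (\<lambda>i. b (\<tau> i)) = 0" using G0 by simp
      moreover have "G v = G (\<lambda>i. b (\<tau> i))"
        by (rule multilinear_formD_cong[OF ml]) (simp add: \<tau>_def \<sigma>)
      ultimately show ?thesis by simp
    next
      case False
      then obtain i j where "i < k" "j < k" "i \<noteq> j" "\<tau> i = \<tau> j" by (auto simp: inj_on_def)
      then show ?thesis using \<sigma> by (intro alternating_form_eq_0[OF alt, of i j]) (auto simp: \<tau>_def)
    qed
  next
    case (Suc n)
    have "G (v(n := x)) = 0" for x
    proof (rule linear_eq_0_span[OF _ _ span, of "\<lambda>x. G (v(n := x))"])
      show "linear (\<lambda>x. G (v(n := x)))"
        using Suc.prems(1) by (intro multilinear_formD_linear[OF ml]) simp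
    next
      fix x assume "x \<in> b ` {..<k}"
      then show "G (v(n := x)) = 0"
        using Suc.prems by (intro Suc.IH) auto
    qed
    from this[of "v n"] show ?case by simp
  qed
  from this[of k v] show ?thesis by simp
qed

text \<open>The difference of the two sides is itself a top form, and it vanishes at
  \<open>b\<close>. The product form of the claim avoids dividing by \<open>F b\<close>.\<close>

lemma alternating_top_forms_proportional:
  assumes "multilinear_form k F" "alternating_form k F" "multilinear_form k G" "alternating_form k G"
    and "span (b ` {..<k}) = UNIV"
  shows "F b * G v = G b * F v"
proof -
  define H where "H = (\<lambda>v. F b * G v - G b * F v)"
  have "multilinear_form k H"
    unfolding multilinear_form_def H_def
  proof (intro conjI allI impI)
    fix v w :: "nat \<Rightarrow> 'a" assume "\<forall>i<k. v i = w i"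
    then have "F v = F w" "G v = G w"
      using assms(1,3) by (auto intro: multilinear_formD_cong)
    then show "F b * G v - G b * F v = F b * G w - G b * F w" by simp
  next
    fix v :: "nat \<Rightarrow> 'a" and i assume "i < k"
    then show "linear (\<lambda>x. F b * G (v(i := x)) - G b * F (v(i := x)))"
      using assms(1,3)[THEN multilinear_formD_linear, of i v]
      by (simp add: linear_iff algebra_simps)
  qed
  moreover have "alternating_form k H"
    using assms(2,4) by (simp add: alternating_form_def H_def algebra_simps)
  ultimately have "H v = 0"
    by (rule alternating_top_form_eq_0[OF _ _ assms(5)]) (simp add: H_def)
  then show ?thesis by (simp add: H_def)
qed

section \<open>Positivity on symplectic tuples\<close>

text \<open>The Gram matrix of a symplectic basis, with blocks \<open>{2q, 2q + 1}\<close>: inside a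
  block \<open>real j - real i\<close> is 0 on the diagonal, 1 for increasing indices and -1 for
  decreasing ones.\<close>

definition symplectic_tuple :: "('v \<Rightarrow> 'v \<Rightarrow> real) \<Rightarrow> nat \<Rightarrow> (nat \<Rightarrow> 'v) \<Rightarrow> bool"
  where "symplectic_tuple \<omega> m w \<longleftrightarrow> (\<forall>i<2*m. \<forall>j<2*m.
    \<omega> (w i) (w j) = (if i div 2 = j div 2 then real j - real i else 0))"

text \<open>For a permutation that fixes the first \<open>k\<close> indices this extracts its sign
  from the second factor of a wedge, where it cancels the sign in front of the summand. A
  transposition of \<open>a\<close> and \<open>b\<close> acts on the shifted arguments as that of
  \<open>a - k\<close> and \<open>b - k\<close>.\<close>

lemma alternating_form_shift:
  assumes G: "alternating_form n G" and \<sigma>: "\<sigma> permutes {k..<k + n}"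
  shows "G (\<lambda>i. w (\<sigma> (k + i))) = of_int (sign \<sigma>) * G (\<lambda>i. w (k + i))"
  using \<sigma> finite_atLeastLessThan
proof (induction arbitrary: w rule: permutes_induct)
  case id
  then show ?case by simp
next
  case (swap a b p)
  have "G (\<lambda>i. w ((Transposition.transpose a b \<circ> p) (k + i))) = of_int (sign p) * G (\<lambda>i. w (Transposition.transpose a b (k + i)))"
    using swap.IH[of "\<lambda>i. w (Transposition.transpose a b i)"] by simp
  also have "(\<lambda>i. w (Transposition.transpose a b (k + i))) = (\<lambda>i. w (k + Transposition.transpose (a - k) (b - k) i))"
    using swap.hyps(1,2) by (auto simp: Transposition.transpose_def fun_eq_iff)
  also have "G \<dots> = - G (\<lambda>i. w (k + i))"
    using alternating_formD[OF G, of "Transposition.transpose (a - k) (b - k)" "\<lambda>i. w (k + i)"] swap.hyps(1-3)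
    by (auto simp: sign_swap_id permutes_swap_id)
  also have "of_int (sign p) * - G (\<lambda>i. w (k + i)) =
      of_int (sign (Transposition.transpose a b \<circ> p)) * G (\<lambda>i. w (k + i))"
  proof -
    have "permutation p" using swap.hyps(4) by (auto simp: permutation_permutes)
    from sign_compose[OF permutation_swap_id[of a b] this] show ?thesis
      using swap.hyps(3) by (simp add: sign_swap_id)
  qed
  finally show ?case .
qed

text \<open>Exchanging the blocks 0 and \<open>j\<close> takes two transpositions (none if
  \<open>j = 0\<close>), so it is an even permutation.\<close>

definition block_transpose :: "nat \<Rightarrow> nat \<Rightarrow> nat"
  where "block_transpose j = Transposition.transpose 0 (2 * j) \<circ> Transposition.transpose 1 (2 * j + 1)"

lemma block_transpose_eq:
  "block_transpose j i = 2 * Transposition.transpose 0 j (i div 2) + i mod 2"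
proof -
  have "i = 2 * (i div 2) + i mod 2" "i mod 2 < 2" by auto
  then obtain q r where i: "i = 2 * q + r" "r < 2" "q = i div 2" "r = i mod 2" by blast
  then have "r = 0 \<or> r = 1" by auto
  then show ?thesis unfolding i(3,4)[symmetric] using i(1)
    by (auto simp: block_transpose_def Transposition.transpose_def)
qed

lemma block_transpose_involutory: "block_transpose j (block_transpose j i) = i"
  by (simp add: block_transpose_eq)

lemma block_transpose_permutes: "j < n \<Longrightarrow> block_transpose j permutes {..<2 * n}"
  unfolding block_transpose_def by (intro permutes_compose permutes_swap_id) auto

lemma sign_block_transpose: "sign (block_transpose j) = 1"
  unfolding block_transpose_def
  by (subst sign_compose) (auto simp: sign_swap_id permutation_swap_id)

text \<open>The prescribed value depends only on whether two indices share a block and on their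
  positions within it; exchanging whole blocks preserves both.\<close>

lemma symplectic_tuple_block_transpose:
  assumes "symplectic_tuple \<omega> m w" "j < m"
  shows "symplectic_tuple \<omega> m (\<lambda>i. w (block_transpose j i))"
  unfolding symplectic_tuple_def
proof (intro allI impI)
  fix a b :: nat assume ab: "a < 2 * m" "b < 2 * m"
  let ?t = "Transposition.transpose 0 j"
  have div: "block_transpose j i div 2 = ?t (i div 2)" and
    mod: "real (block_transpose j i) = 2 * real (?t (i div 2)) + real (i mod 2)" for i
    by (simp_all add: block_transpose_eq)
  have re: "real i = 2 * real (i div 2) + real (i mod 2)" for i
    using arg_cong[OF mult_div_mod_eq[of 2 i], of real] by (simp only: of_nat_add of_nat_mult of_nat_numeral)
  have "?t (a div 2) = ?t (b div 2) \<longleftrightarrow> a div 2 = b div 2"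
    by (metis transpose_involutory)
  moreover have "block_transpose j a < 2 * m" "block_transpose j b < 2 * m"
    using ab permutes_in_image[OF block_transpose_permutes[OF assms(2)]] by auto
  ultimately show "\<omega> (w (block_transpose j a)) (w (block_transpose j b)) =
      (if a div 2 = b div 2 then real b - real a else 0)"
    using assms(1) re[of a] re[of b] by (simp add: symplectic_tuple_def div mod)
qed

text \<open>Every nonzero term of the sum defining \<open>\<omega>\<^sup>m\<close> on a symplectic tuple is positive: moving the
  block of its first two indices to the front, and possibly exchanging these two, changes neither
  the term nor the hypothesis.\<close>

lemma wedge_power2_pos:
  assumes "symplectic_tuple \<omega> m w"
  shows "wedge_power2 \<omega> m w > 0"
  using assms
proof (induction m arbitrary: w)
  case 0
  then show ?case by simp
next
  case (Suc m)
  define G where "G = wedge_power2 \<omega> m"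
  \<comment> \<open>The tuple is a parameter because moving a block to the front changes the tuple
    together with the permutation.\<close>
  define summand where "summand w \<sigma> = of_int (sign \<sigma>) * \<omega> (w (\<sigma> 0)) (w (\<sigma> 1)) * G (\<lambda>i. w (\<sigma> (2 + i)))"
    for w and \<sigma> :: "nat \<Rightarrow> nat"
  let ?P = "{\<sigma>. \<sigma> permutes {..<2 + 2 * m}}"
  have alt: "alternating_form (2 * m) G"
    unfolding G_def by (rule alternating_form_wedge_power2)
  have fixed: "summand w \<sigma> > 0"
    if \<sigma>: "\<sigma> \<in> ?P" and w: "symplectic_tuple \<omega> (Suc m) w" and "\<sigma> 0 = 0" "\<sigma> 1 = 1" for w \<sigma>
  proof -
    have "\<sigma> permutes {2..<2 + 2 * m}"
    proof (rule permutes_superset)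
      show "\<sigma> permutes {..<2 + 2 * m}" using \<sigma> by simp
      fix x assume "x \<in> {..<2 + 2 * m} - {2..<2 + 2 * m}"
      then have "x = 0 \<or> x = 1" by auto
      then show "\<sigma> x = x" using that by auto
    qed
    then have "G (\<lambda>i. w (\<sigma> (2 + i))) = of_int (sign \<sigma>) * G (\<lambda>i. w (2 + i))"
      by (rule alternating_form_shift[OF alt])
    moreover have "\<omega> (w 0) (w 1) = 1" using w by (simp add: symplectic_tuple_def)
    moreover have "of_int (sign \<sigma>) * of_int (sign \<sigma>) = (1::real)"
      by (metis of_int_1 of_int_mult sign_idempotent)
    ultimately have "summand w \<sigma> = G (\<lambda>i. w (2 + i))"
      using that by (simp add: summand_def mult.assoc[symmetric])
    also have "\<dots> > 0"
      unfolding G_def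
    proof (rule Suc.IH)
      show "symplectic_tuple \<omega> m (\<lambda>i. w (2 + i))"
        using w by (auto simp: symplectic_tuple_def)
    qed
    finally show ?thesis .
  qed
  have first_block: "summand w \<sigma> > 0"
    if \<sigma>: "\<sigma> \<in> ?P" and w: "symplectic_tuple \<omega> (Suc m) w" and "\<sigma> 0 div 2 = 0" "\<sigma> 1 div 2 = 0" for w \<sigma>
  proof -
    have "\<sigma> 0 \<noteq> \<sigma> 1" using \<sigma> by (metis mem_Collect_eq permutes_def zero_neq_one)
    moreover have "\<sigma> 0 = 0 \<or> \<sigma> 0 = 1" "\<sigma> 1 = 0 \<or> \<sigma> 1 = 1" using that by auto
    ultimately consider "\<sigma> 0 = 0" "\<sigma> 1 = 1" | "\<sigma> 0 = 1" "\<sigma> 1 = 0" by metis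
    then show ?thesis
    proof cases
      case 1
      then show ?thesis using fixed[OF \<sigma> w] by simp
    next
      case 2
      let ?t = "Transposition.transpose (0::nat) 1"
      have t: "?t permutes {..<2 + 2 * m}" by (intro permutes_swap_id) auto
      have "\<sigma> \<circ> ?t \<in> ?P" using \<sigma> t by (auto intro: permutes_compose)
      from fixed[OF this w] have "summand w (\<sigma> \<circ> ?t) > 0" using 2 by simp
      moreover have "sign (\<sigma> \<circ> ?t) = - sign \<sigma>"
        using \<sigma> t by (subst sign_compose) (auto simp: sign_swap_id permutation_permutes)
      moreover have "\<omega> (w 0) (w 1) = 1" "\<omega> (w 1) (w 0) = -1"
        using w by (simp_all add: symplectic_tuple_def)
      moreover have "(\<sigma> \<circ> ?t) (2 + i) = \<sigma> (2 + i)" for i by (simp add: Transposition.transpose_def)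
      ultimately show ?thesis using 2 by (simp add: summand_def del: add_2_eq_Suc)
    qed
  qed
  have nonneg: "summand w \<sigma> \<ge> 0" if \<sigma>: "\<sigma> \<in> ?P" for \<sigma>
  proof (cases "\<sigma> 0 div 2 = \<sigma> 1 div 2")
    case True
    define j where "j = \<sigma> 0 div 2"
    let ?b = "block_transpose j"
    have "\<sigma> 0 < 2 * Suc m" using \<sigma> permutes_in_image[of \<sigma> "{..<2 + 2 * m}" 0] by simp
    then have j: "j < Suc m" by (auto simp: j_def)
    have b: "?b permutes {..<2 + 2 * m}" using block_transpose_permutes[OF j] by simp
    have "?b \<circ> \<sigma> \<in> ?P" using \<sigma> b by (auto intro: permutes_compose)
    from first_block[OF this symplectic_tuple_block_transpose[OF Suc.prems j]]
    \<comment> \<open>Since \<open>?b\<close> is an involution, this tuple composed with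
      \<open>?b \<circ> \<sigma>\<close> is again \<open>w\<close> composed with \<sigma>, so the
      summand is the original one.\<close>
    have "summand (\<lambda>i. w (?b i)) (?b \<circ> \<sigma>) > 0"
      using True by (simp add: block_transpose_eq j_def)
    moreover have "sign (?b \<circ> \<sigma>) = sign \<sigma>"
      using \<sigma> b by (subst sign_compose) (auto simp: sign_block_transpose permutation_permutes)
    ultimately show ?thesis
      by (simp add: summand_def block_transpose_involutory)
  next
    case False
    moreover have "\<sigma> 0 < 2 * Suc m" "\<sigma> 1 < 2 * Suc m"
      using \<sigma> permutes_in_image[of \<sigma> "{..<2 + 2 * m}"] by auto
    ultimately have "\<omega> (w (\<sigma> 0)) (w (\<sigma> 1)) = 0"
      using Suc.prems by (simp add: symplectic_tuple_def)
    then show ?thesis by (simp add: summand_def)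
  qed
  \<comment> \<open>All summands are nonnegative, so one strictly positive summand suffices, and the
    identity provides it.\<close>
  have "0 < (\<Sum>\<sigma>\<in>?P. summand w \<sigma>)"
  proof (rule sum_pos2[of _ id])
    show "0 < summand w id" by (rule fixed) (auto simp: permutes_id Suc.prems)
  qed (auto simp: finite_permutations permutes_id nonneg)
  then show ?case by (simp add: wedge_def summand_def G_def)
qed

text \<open>As \<eta> vanishes on every vector of the tuple but \<open>w 0\<close>, only the
  permutations fixing 0 contribute, and each of them contributes the positive value of the wedge
  power on the remaining vectors.\<close>

lemma wedge1_wedge_power2_pos:
  assumes w: "symplectic_tuple \<omega> m (\<lambda>i. w (1 + i))"
    and \<eta>: "\<eta> (w 0) = 1" "\<And>i. 1 \<le> i \<Longrightarrow> i < 2 * m + 1 \<Longrightarrow> \<eta> (w i) = 0"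
  shows "wedge 1 (2 * m) (\<lambda>v. \<eta> (v 0)) (wedge_power2 \<omega> m) w > 0"
proof -
  let ?P = "{\<sigma>. \<sigma> permutes {..<1 + 2 * m}}"
  let ?G = "wedge_power2 \<omega> m"
  define summand where "summand \<sigma> = of_int (sign \<sigma>) * \<eta> (w (\<sigma> 0)) * ?G (\<lambda>i. w (\<sigma> (1 + i)))"
    for \<sigma> :: "nat \<Rightarrow> nat"
  have fixed: "summand \<sigma> > 0" if \<sigma>: "\<sigma> \<in> ?P" and "\<sigma> 0 = 0" for \<sigma>
  proof -
    have "\<sigma> permutes {1..<1 + 2 * m}"
    proof (rule permutes_superset)
      show "\<sigma> permutes {..<1 + 2 * m}" using \<sigma> by simp
      fix x assume "x \<in> {..<1 + 2 * m} - {1..<1 + 2 * m}"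
      then have "x = 0" by auto
      then show "\<sigma> x = x" using that by simp
    qed
    then have "?G (\<lambda>i. w (\<sigma> (1 + i))) = of_int (sign \<sigma>) * ?G (\<lambda>i. w (1 + i))"
      by (rule alternating_form_shift[OF alternating_form_wedge_power2])
    moreover have "of_int (sign \<sigma>) * of_int (sign \<sigma>) = (1::real)"
      by (metis of_int_1 of_int_mult sign_idempotent)
    ultimately show ?thesis
      using wedge_power2_pos[OF w] that \<eta> by (simp add: summand_def mult.assoc[symmetric])
  qed
  have nonneg: "summand \<sigma> \<ge> 0" if \<sigma>: "\<sigma> \<in> ?P" for \<sigma>
  proof (cases "\<sigma> 0 = 0")
    case True
    then show ?thesis using fixed[OF \<sigma>] by simp
  next
    case False
    moreover have "\<sigma> 0 < 2 * m + 1"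
      using \<sigma> permutes_in_image[of \<sigma> "{..<1 + 2 * m}" 0] by simp
    ultimately show ?thesis using \<eta>(2)[of "\<sigma> 0"] by (simp add: summand_def)
  qed
  have "0 < (\<Sum>\<sigma>\<in>?P. summand \<sigma>)"
  proof (rule sum_pos2[of _ id])
    show "0 < summand id" by (rule fixed) (auto simp: permutes_id)
  qed (auto simp: finite_permutations permutes_id nonneg)
  then show ?thesis by (simp add: wedge_def summand_def)
qed


section \<open>Almost contact metric structures on a vector space\<close>

text \<open>The structure at a single point. The metric \<open>g\<close> is unrelated to the inner
  product of the type \<open>'e\<close>, hence the separate notion of orthonormality below.\<close>

locale contact_metric_space =
  fixes \<phi> :: "'e::euclidean_space \<Rightarrow> 'e" and \<xi> :: 'e and \<eta> :: "'e \<Rightarrow> real"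
    and g :: "'e \<Rightarrow> 'e \<Rightarrow> real"
  assumes linear_\<phi>: "linear \<phi>" and linear_\<eta>: "linear \<eta>" and bilinear_g: "bilinear g"
    and g_sym: "g v w = g w v" and g_pos: "v \<noteq> 0 \<Longrightarrow> g v v > 0"
    and \<phi>_\<phi>: "\<phi> (\<phi> v) = - v + \<eta> v *\<^sub>R \<xi>" and \<eta>_\<xi>: "\<eta> \<xi> = 1"
    and g_\<phi>_\<phi>: "g (\<phi> v) (\<phi> w) = g v w - \<eta> v * \<eta> w"
begin

lemmas g_simps =
  bilinear_ladd[OF bilinear_g] bilinear_radd[OF bilinear_g]
  bilinear_lmul[OF bilinear_g] bilinear_rmul[OF bilinear_g]
  bilinear_lneg[OF bilinear_g] bilinear_rneg[OF bilinear_g]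
  bilinear_lsub[OF bilinear_g] bilinear_rsub[OF bilinear_g]
  bilinear_lzero[OF bilinear_g] bilinear_rzero[OF bilinear_g]

lemma \<xi>_nonzero: "\<xi> \<noteq> 0"
  using \<eta>_\<xi> linear_0[OF linear_\<eta>] by auto

text \<open>The square of \<phi> kills \<xi>. Applied to \<phi> \<xi> instead, the formula for the
  square makes \<phi> \<xi> a multiple of \<xi>; applying \<phi> once more shows that the factor or
  the vector itself is zero.\<close>

lemma \<phi>_\<xi>: "\<phi> \<xi> = 0"
proof -
  have 1: "\<phi> (\<phi> \<xi>) = 0" by (simp add: \<phi>_\<phi> \<eta>_\<xi>)
  have "\<phi> (\<phi> (\<phi> \<xi>)) = 0" by (simp add: 1 linear_0[OF linear_\<phi>])
  then have 2: "\<phi> \<xi> = \<eta> (\<phi> \<xi>) *\<^sub>R \<xi>" using \<phi>_\<phi>[of "\<phi> \<xi>"] by simp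
  then have "\<phi> (\<phi> \<xi>) = \<eta> (\<phi> \<xi>) *\<^sub>R \<phi> \<xi>"
    by (metis linear_cmul[OF linear_\<phi>])
  then show ?thesis using 1 2 by (metis scaleR_eq_0_iff)
qed

text \<open>The cube of \<phi> is evaluated in two ways, once with the square applied first and once
  with it applied last.\<close>

lemma \<eta>_\<phi>: "\<eta> (\<phi> v) = 0"
proof -
  have "\<phi> (- v + \<eta> v *\<^sub>R \<xi>) = - \<phi> v"
    by (simp add: linear_add[OF linear_\<phi>] linear_neg[OF linear_\<phi>] linear_cmul[OF linear_\<phi>] linear_diff[OF linear_\<phi>] \<phi>_\<xi>)
  then have "\<eta> (\<phi> v) *\<^sub>R \<xi> = 0" using \<phi>_\<phi>[of "\<phi> v"] by (simp add: \<phi>_\<phi>[of v])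
  then show ?thesis using \<xi>_nonzero by simp
qed

lemma g_\<xi>: "g v \<xi> = \<eta> v"
  using g_\<phi>_\<phi>[of v \<xi>] by (simp add: \<phi>_\<xi> \<eta>_\<xi> g_simps)

lemma g_\<phi>: "g (\<phi> v) w = - g v (\<phi> w)"
  using g_\<phi>_\<phi>[of v "\<phi> w"] by (simp add: \<phi>_\<phi> g_simps g_\<xi> \<eta>_\<phi>)

text \<open>The kernel of the fundamental form is the line through \<xi>: by skewness \<phi> z has
  length zero, and then the formula for the square of \<phi> reads 0 = - z + \<xi>.\<close>

lemma reeb_unique:
  assumes "\<eta> z = 1" "\<And>v. g z (\<phi> v) = 0"
  shows "z = \<xi>"
proof -
  have "g (\<phi> z) (\<phi> z) = 0" using assms(2) by (simp add: g_\<phi>)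
  then have "\<phi> z = 0" using g_pos[of "\<phi> z"] by auto
  then have "\<phi> (\<phi> z) = 0" by (simp add: linear_0[OF linear_\<phi>])
  then show ?thesis by (simp add: \<phi>_\<phi> assms)
qed

section \<open>Adapted orthonormal bases\<close>

definition orthonormal_tuple :: "nat \<Rightarrow> (nat \<Rightarrow> 'e) \<Rightarrow> bool"
  where "orthonormal_tuple n b \<longleftrightarrow> (\<forall>i<n. \<forall>j<n. g (b i) (b j) = (if i = j then 1 else 0))"

lemma g_sum_left: "g (\<Sum>i\<in>I. f i) w = (\<Sum>i\<in>I. g (f i) w)"
proof -
  have "linear (\<lambda>v. g v w)" using bilinear_g by (simp add: bilinear_def)
  from linear_sum[OF this] show ?thesis .
qed

lemma orthonormal_tuple_independent:
  assumes b: "orthonormal_tuple n b"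
  shows "inj_on b {..<n}" "independent (b ` {..<n})"
proof -
  show inj: "inj_on b {..<n}"
  proof (rule inj_onI)
    fix i j assume ij: "i \<in> {..<n}" "j \<in> {..<n}" "b i = b j"
    then have "g (b i) (b j) = 1" using b by (simp add: orthonormal_tuple_def)
    then show "i = j" using b ij unfolding orthonormal_tuple_def
      by (metis lessThan_iff zero_neq_one)
  qed
  show "independent (b ` {..<n})"
  proof (rule independent_if_scalars_zero)
    fix f x assume 0: "(\<Sum>x\<in>b ` {..<n}. f x *\<^sub>R x) = 0" and "x \<in> b ` {..<n}"
    then obtain j where j: "j < n" "x = b j" by auto
    have "0 = g (\<Sum>i<n. f (b i) *\<^sub>R b i) (b j)"
      using 0 by (simp add: sum.reindex[OF inj] g_simps)
    also have "\<dots> = (\<Sum>i<n. f (b i) * g (b i) (b j))"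
      by (simp add: g_sum_left g_simps)
    also have "\<dots> = (\<Sum>i<n. if i = j then f (b i) else 0)"
      using b j by (intro sum.cong) (auto simp: orthonormal_tuple_def)
    also have "\<dots> = f (b j)" using j by simp
    finally show "f x = 0" using j by simp
  qed simp
qed

lemma orthonormal_tuple_dim_le: "orthonormal_tuple n b \<Longrightarrow> n \<le> DIM('e)"
  using orthonormal_tuple_independent[of n b] independent_card_le[of "b ` {..<n}"]
  by (simp add: card_image)

text \<open>One Gram-Schmidt step for \<open>g\<close>: a vector outside the span minus its
  projection, which lies in the span, is nonzero and can be normalised.\<close>

lemma orthonormal_tuple_extend:
  assumes b: "orthonormal_tuple n b" and "span (b ` {..<n}) \<noteq> UNIV"
  obtains u where "g u u = 1" "\<And>i. i < n \<Longrightarrow> g u (b i) = 0"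
proof -
  obtain x where x: "x \<notin> span (b ` {..<n})" using assms(2) by auto
  define y where "y = x - (\<Sum>i<n. g x (b i) *\<^sub>R b i)"
  have "(\<Sum>i<n. g x (b i) *\<^sub>R b i) \<in> span (b ` {..<n})"
    by (intro span_sum span_scale span_base) auto
  then have "y \<noteq> 0" using x by (auto simp: y_def)
  have orth: "g y (b j) = 0" if j: "j < n" for j
  proof -
    have "g y (b j) = g x (b j) - (\<Sum>i<n. g x (b i) * g (b i) (b j))"
      by (simp add: y_def g_simps g_sum_left)
    also have "(\<Sum>i<n. g x (b i) * g (b i) (b j)) = (\<Sum>i<n. if i = j then g x (b i) else 0)"
      using b j by (intro sum.cong) (auto simp: orthonormal_tuple_def)
    finally show ?thesis using j by simp
  qed
  define r where "r = 1 / sqrt (g y y)"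
  show ?thesis
  proof
    have "g y y > 0" using g_pos \<open>y \<noteq> 0\<close> by simp
    then have "r * r * g y y = 1" by (simp add: r_def)
    then show "g (r *\<^sub>R y) (r *\<^sub>R y) = 1" by (simp add: g_simps mult.assoc)
    show "g (r *\<^sub>R y) (b i) = 0" if "i < n" for i using orth[OF that] by (simp add: g_simps)
  qed
qed

text \<open>Placing \<phi> u before u makes the fundamental form equal to +1 on each pair in this
  order, as \<open>symplectic_tuple\<close> demands once \<xi> is dropped.\<close>

definition adapted_tuple :: "nat \<Rightarrow> (nat \<Rightarrow> 'e) \<Rightarrow> bool"
  where "adapted_tuple k b \<longleftrightarrow> orthonormal_tuple (2 * k + 1) b \<and> b 0 = \<xi> \<and>
    (\<forall>j<k. b (2 * j + 1) = \<phi> (b (2 * j + 2)))"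

lemma adapted_tuple_\<eta>:
  assumes "adapted_tuple k b" "1 \<le> i" "i < 2 * k + 1"
  shows "\<eta> (b i) = 0"
  using assms g_\<xi>[of "b i"] by (auto simp: adapted_tuple_def orthonormal_tuple_def)

lemma adapted_tuple_\<phi>:
  assumes "adapted_tuple k b" "j < k"
  shows "\<phi> (b (2 * j + 2)) = b (2 * j + 1)" "\<phi> (b (2 * j + 1)) = - b (2 * j + 2)"
proof -
  show 1: "\<phi> (b (2 * j + 2)) = b (2 * j + 1)" using assms by (simp add: adapted_tuple_def)
  have "\<eta> (b (2 * j + 2)) = 0" using assms by (intro adapted_tuple_\<eta>) auto
  then have "\<phi> (\<phi> (b (2 * j + 2))) = - b (2 * j + 2)" by (simp only: \<phi>_\<phi>) simp
  then show "\<phi> (b (2 * j + 1)) = - b (2 * j + 2)" by (simp only: 1)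
qed

lemma adapted_tuple_symplectic:
  assumes b: "adapted_tuple k b"
  shows "symplectic_tuple (\<lambda>v w. g v (\<phi> w)) k (\<lambda>i. b (1 + i))"
  unfolding symplectic_tuple_def
proof (intro allI impI)
  fix i j :: nat assume ij: "i < 2 * k" "j < 2 * k"
  define q where "q = j div 2"
  have q: "q < k" using ij by (auto simp: q_def)
  have on: "g (b (1 + i)) (b (1 + i')) = (if i = i' then 1 else 0)" if "i' < 2 * k" for i'
    using b that ij by (simp add: adapted_tuple_def orthonormal_tuple_def)
  consider "j = 2 * q" | "j = 2 * q + 1" unfolding q_def by linarith
  then show "g (b (1 + i)) (\<phi> (b (1 + j))) = (if i div 2 = j div 2 then real j - real i else 0)"
  proof cases
    case 1
    then have "\<phi> (b (1 + j)) = - b (1 + (2 * q + 1))"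
      using adapted_tuple_\<phi>[OF b q] by (simp add: add.commute)
    then have "g (b (1 + i)) (\<phi> (b (1 + j))) = (if i = 2 * q + 1 then - 1 else 0)"
      using on[of "2 * q + 1"] q by (simp add: g_simps)
    moreover have "i div 2 = q \<longleftrightarrow> i = 2 * q \<or> i = 2 * q + 1" by auto
    ultimately show ?thesis using 1 by auto
  next
    case 2
    then have "\<phi> (b (1 + j)) = b (1 + 2 * q)"
      using adapted_tuple_\<phi>[OF b q] by (simp add: add.commute)
    then have "g (b (1 + i)) (\<phi> (b (1 + j))) = (if i = 2 * q then 1 else 0)"
      using on[of "2 * q"] q by simp
    moreover have "i div 2 = q \<longleftrightarrow> i = 2 * q \<or> i = 2 * q + 1" by auto
    ultimately show ?thesis using 2 by auto
  qed
qed

text \<open>A unit vector \<open>u\<close> orthogonal to the tuple is orthogonal to \<xi>, so \<phi>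
  u is again a unit vector. Skewness makes \<phi> u orthogonal to \<open>u\<close>, and also to the
  tuple, because \<phi> maps the tuple into itself up to sign, except for \<xi>, which it
  kills.\<close>

lemma adapted_tuple_extend:
  assumes b: "adapted_tuple k b" and "span (b ` {..<2 * k + 1}) \<noteq> UNIV"
  shows "\<exists>b'. adapted_tuple (Suc k) b'"
proof -
  have on: "orthonormal_tuple (2 * k + 1) b" using b by (simp add: adapted_tuple_def)
  obtain u where u: "g u u = 1" "\<And>i. i < 2 * k + 1 \<Longrightarrow> g u (b i) = 0"
    using orthonormal_tuple_extend[OF on assms(2)] by blast
  have "\<eta> u = 0" using u(2)[of 0] b by (simp add: adapted_tuple_def g_\<xi>)
  then have \<phi>u: "g (\<phi> u) (\<phi> u) = 1" using u by (simp add: g_\<phi>_\<phi>)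
  have u\<phi>u: "g u (\<phi> u) = 0" "g (\<phi> u) u = 0" using g_\<phi>[of u u] g_sym[of u "\<phi> u"] by auto
  have orth: "g (\<phi> u) (b i) = 0" if "i < 2 * k + 1" for i
  proof -
    consider "i = 0" | j where "j < k" "i = 2 * j + 1" | j where "j < k" "i = 2 * j + 2"
    proof (cases "i = 0")
      case False
      then have "(i - 1) div 2 < k" "i = 2 * ((i - 1) div 2) + 1 \<or> i = 2 * ((i - 1) div 2) + 2"
        using \<open>i < 2 * k + 1\<close> by auto
      then show ?thesis using that by blast
    qed (use that in blast)
    then show ?thesis
    proof cases
      case 1
      then show ?thesis using b by (simp add: adapted_tuple_def g_\<xi> \<eta>_\<phi>)
    next
      case 2
      then show ?thesis using adapted_tuple_\<phi>[OF b \<open>j < k\<close>] u(2)[of "2 * j + 2"] by (simp add: g_\<phi> g_simps)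
    next
      case 3
      then show ?thesis using adapted_tuple_\<phi>[OF b \<open>j < k\<close>] u(2)[of "2 * j + 1"] by (simp add: g_\<phi> g_simps)
    qed
  qed
  define b' where "b' = b(2 * k + 1 := \<phi> u, 2 * k + 2 := u)"
  have b': "b' (2 * k + 1) = \<phi> u" "b' (2 * k + 2) = u" "\<And>i. i < 2 * k + 1 \<Longrightarrow> b' i = b i"
    by (auto simp: b'_def)
  have "adapted_tuple (Suc k) b'"
    unfolding adapted_tuple_def
  proof (intro conjI allI impI)
    show "b' 0 = \<xi>" using b by (simp add: b' adapted_tuple_def)
    show "orthonormal_tuple (2 * Suc k + 1) b'"
      unfolding orthonormal_tuple_def
    proof (intro allI impI)
      fix i j assume "i < 2 * Suc k + 1" "j < 2 * Suc k + 1"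
      then have "i < 2 * k + 1 \<or> i = 2 * k + 1 \<or> i = 2 * k + 2"
        "j < 2 * k + 1 \<or> j = 2 * k + 1 \<or> j = 2 * k + 2" by auto
      moreover have "g (b i) (b j) = (if i = j then 1 else 0)" if "i < 2 * k + 1" "j < 2 * k + 1"
        using on that unfolding orthonormal_tuple_def by blast
      moreover have "g (b i) u = 0" "g (b i) (\<phi> u) = 0" if "i < 2 * k + 1" for i
        using u(2)[OF that] orth[OF that] g_sym by metis+
      ultimately show "g (b' i) (b' j) = (if i = j then 1 else 0)"
        using u orth \<phi>u u\<phi>u by (elim disjE) (simp_all only: b', auto)
    qed
    fix j assume "j < Suc k"
    then have "j < k \<or> j = k" by auto
    then show "b' (2 * j + 1) = \<phi> (b' (2 * j + 2))"
    proof
      assume "j < k"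
      then have "2 * j + 1 < 2 * k + 1" "2 * j + 2 < 2 * k + 1" by auto
      then show ?thesis using adapted_tuple_\<phi>[OF b \<open>j < k\<close>] by (simp only: b')
    qed (simp only: b')
  qed
  then show ?thesis by blast
qed

text \<open>A maximal adapted tuple spans. Its length is odd by construction, which is why the
  dimension is.\<close>

lemma adapted_basis:
  obtains m b where "DIM('e) = 2 * m + 1" "span (b ` {..<2 * m + 1}) = UNIV" "b 0 = \<xi>"
    "\<And>i. 1 \<le> i \<Longrightarrow> i < 2 * m + 1 \<Longrightarrow> \<eta> (b i) = 0"
    "symplectic_tuple (\<lambda>v w. g v (\<phi> w)) m (\<lambda>i. b (1 + i))"
proof -
  have "\<exists>k b. adapted_tuple k b \<and> span (b ` {..<2 * k + 1}) = UNIV"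
  proof (rule ccontr)
    assume *: "\<nexists>k b. adapted_tuple k b \<and> span (b ` {..<2 * k + 1}) = UNIV"
    have "\<exists>b. adapted_tuple k b" for k
    proof (induction k)
      case 0
      have "adapted_tuple 0 (\<lambda>_. \<xi>)" by (simp add: adapted_tuple_def orthonormal_tuple_def g_\<xi> \<eta>_\<xi>)
      then show ?case by blast
    next
      case (Suc k)
      then show ?case using * adapted_tuple_extend by blast
    qed
    \<comment> \<open>Such a tuple would contain 2 * DIM('e) + 1 orthonormal vectors, more than the
      dimension allows.\<close>
    from this[of "DIM('e)"] obtain b where "adapted_tuple DIM('e) b" by blast
    then show False using orthonormal_tuple_dim_le by (fastforce simp: adapted_tuple_def)
  qed
  then obtain k b where b: "adapted_tuple k b" "span (b ` {..<2 * k + 1}) = UNIV" by blast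
  have on: "orthonormal_tuple (2 * k + 1) b" using b by (simp add: adapted_tuple_def)
  have "DIM('e) \<le> 2 * k + 1"
    using b(2) card_image_le[of "{..<2 * k + 1}" b] dim_le_card[of UNIV "b ` {..<2 * k + 1}"]
    by (simp add: dim_UNIV)
  moreover have "2 * k + 1 \<le> DIM('e)" by (rule orthonormal_tuple_dim_le[OF on])
  ultimately have dim: "DIM('e) = 2 * k + 1" by simp
  have b0: "b 0 = \<xi>" using b(1) by (simp add: adapted_tuple_def)
  show ?thesis
    by (rule that[OF dim b(2) b0 adapted_tuple_\<eta>[OF b(1)] adapted_tuple_symplectic[OF b(1)]])
qed

end

lemma linear_multilinear_form_1: "linear f \<Longrightarrow> multilinear_form 1 (\<lambda>v. f (v 0))"
  unfolding multilinear_form_def by simp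

section \<open>Almost contact metric 3-structures on a vector space\<close>

locale contact_metric_3_space =
  fixes \<phi> :: "3 \<Rightarrow> 'e::euclidean_space \<Rightarrow> 'e" and \<xi> :: "3 \<Rightarrow> 'e" and \<eta> :: "3 \<Rightarrow> 'e \<Rightarrow> real"
    and g :: "'e \<Rightarrow> 'e \<Rightarrow> real"
  assumes contact_metric: "contact_metric_space (\<phi> \<alpha>) (\<xi> \<alpha>) (\<eta> \<alpha>) g"
    and cyclic: "(\<alpha>, \<beta>, \<gamma>) \<in> {(1, 2, 3), (2, 3, 1), (3, 1, 2)} \<Longrightarrow>
       \<phi> \<gamma> v = \<phi> \<alpha> (\<phi> \<beta> v) - \<eta> \<beta> v *\<^sub>R \<xi> \<alpha> \<and>
       \<phi> \<gamma> v = - \<phi> \<beta> (\<phi> \<alpha> v) + \<eta> \<alpha> v *\<^sub>R \<xi> \<beta> \<and>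
       \<eta> \<gamma> v = \<eta> \<alpha> (\<phi> \<beta> v) \<and> \<eta> \<gamma> v = - \<eta> \<beta> (\<phi> \<alpha> v) \<and>
       \<xi> \<gamma> = \<phi> \<alpha> (\<xi> \<beta>) \<and> \<xi> \<gamma> = - \<phi> \<beta> (\<xi> \<alpha>)"
begin

sublocale S: contact_metric_space "\<phi> \<alpha>" "\<xi> \<alpha>" "\<eta> \<alpha>" g for \<alpha>
  by (rule contact_metric)

text \<open>With the three forms collected in the vector \<open>E v\<close>, the form of index
  \<open>l\<close> is \<open>l \<bullet> E v\<close>, and the structure equations become identities
  in \<open>l\<close> written with the inner and cross products of R^3.\<close>

definition \<Phi> :: "real ^ 3 \<Rightarrow> 'e \<Rightarrow> 'e" where "\<Phi> l v = comb l (\<lambda>\<alpha>. \<phi> \<alpha> v)"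
definition \<Xi> :: "real ^ 3 \<Rightarrow> 'e" where "\<Xi> l = comb l \<xi>"
definition E :: "'e \<Rightarrow> real ^ 3" where "E v = (\<chi> \<alpha>. \<eta> \<alpha> v)"

lemma cyclic_simps:
  assumes "(\<alpha>, \<beta>, \<gamma>) \<in> {(1, 2, 3), (2, 3, 1), (3, 1, 2)}"
  shows "\<phi> \<alpha> (\<phi> \<beta> v) = \<phi> \<gamma> v + \<eta> \<beta> v *\<^sub>R \<xi> \<alpha>" "\<phi> \<beta> (\<phi> \<alpha> v) = - \<phi> \<gamma> v + \<eta> \<alpha> v *\<^sub>R \<xi> \<beta>"
    "\<eta> \<alpha> (\<phi> \<beta> v) = \<eta> \<gamma> v" "\<eta> \<beta> (\<phi> \<alpha> v) = - \<eta> \<gamma> v"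
    "\<phi> \<alpha> (\<xi> \<beta>) = \<xi> \<gamma>" "\<phi> \<beta> (\<xi> \<alpha>) = - \<xi> \<gamma>"
proof -
  note c = cyclic[OF assms, of v]
  from c have "\<phi> \<gamma> v = \<phi> \<alpha> (\<phi> \<beta> v) - \<eta> \<beta> v *\<^sub>R \<xi> \<alpha>" by blast
  then show "\<phi> \<alpha> (\<phi> \<beta> v) = \<phi> \<gamma> v + \<eta> \<beta> v *\<^sub>R \<xi> \<alpha>" by simp
  from c have "\<phi> \<gamma> v = - \<phi> \<beta> (\<phi> \<alpha> v) + \<eta> \<alpha> v *\<^sub>R \<xi> \<beta>" by blast
  then show "\<phi> \<beta> (\<phi> \<alpha> v) = - \<phi> \<gamma> v + \<eta> \<alpha> v *\<^sub>R \<xi> \<beta>" by simp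
  from c show "\<eta> \<alpha> (\<phi> \<beta> v) = \<eta> \<gamma> v" by simp
  from c have "\<eta> \<gamma> v = - \<eta> \<beta> (\<phi> \<alpha> v)" by blast
  then show "\<eta> \<beta> (\<phi> \<alpha> v) = - \<eta> \<gamma> v" by simp
  from c show "\<phi> \<alpha> (\<xi> \<beta>) = \<xi> \<gamma>" by simp
  from c have "\<xi> \<gamma> = - \<phi> \<beta> (\<xi> \<alpha>)" by blast
  then show "\<phi> \<beta> (\<xi> \<alpha>) = - \<xi> \<gamma>" by simp
qed

lemmas \<phi>_\<phi>_table = cyclic_simps(1,2)[of 1 2 3, simplified] cyclic_simps(1,2)[of 2 3 1, simplified]
  cyclic_simps(1,2)[of 3 1 2, simplified]
lemmas \<eta>_\<phi>_table = cyclic_simps(3,4)[of 1 2 3, simplified] cyclic_simps(3,4)[of 2 3 1, simplified]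
  cyclic_simps(3,4)[of 3 1 2, simplified]
lemmas \<phi>_\<xi>_table = cyclic_simps(5,6)[of 1 2 3, simplified] cyclic_simps(5,6)[of 2 3 1, simplified]
  cyclic_simps(5,6)[of 3 1 2, simplified]

text \<open>For distinct indices, the Reeb vector is up to sign an image under the operator
  belonging to the form, and \<eta> \<circ> \<phi> = 0 for each single structure.\<close>

lemma \<eta>_\<xi>_table:
  "\<eta> 1 (\<xi> 2) = 0" "\<eta> 2 (\<xi> 1) = 0" "\<eta> 2 (\<xi> 3) = 0" "\<eta> 3 (\<xi> 2) = 0" "\<eta> 3 (\<xi> 1) = 0" "\<eta> 1 (\<xi> 3) = 0"
  using S.\<eta>_\<phi>[of 1 "\<xi> 2"] S.\<eta>_\<phi>[of 1 "\<xi> 3"] S.\<eta>_\<phi>[of 2 "\<xi> 1"] S.\<eta>_\<phi>[of 2 "\<xi> 3"]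
    S.\<eta>_\<phi>[of 3 "\<xi> 1"] S.\<eta>_\<phi>[of 3 "\<xi> 2"]
  by (simp_all add: \<phi>_\<xi>_table linear_neg[OF S.linear_\<eta>])

lemmas \<phi>_simps = linear_add[OF S.linear_\<phi>] linear_cmul[OF S.linear_\<phi>] linear_neg[OF S.linear_\<phi>]
  linear_diff[OF S.linear_\<phi>]
lemmas \<eta>_simps = linear_add[OF S.linear_\<eta>] linear_cmul[OF S.linear_\<eta>] linear_neg[OF S.linear_\<eta>]
  linear_diff[OF S.linear_\<eta>]

lemma linear_\<Phi>: "linear (\<Phi> l)"
  by (auto simp: linear_iff \<Phi>_def comb_def sum_3 \<phi>_simps algebra_simps)

lemma linear_E: "linear E"
  by (auto simp: linear_iff E_def vec_eq_iff \<eta>_simps)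

lemma linear_\<Xi>: "linear \<Xi>"
  by (auto simp: linear_iff \<Xi>_def comb_def sum_3 algebra_simps)

lemma \<Phi>_linear_index: "linear (\<lambda>l. \<Phi> l v)"
  by (auto simp: linear_iff \<Phi>_def comb_def sum_3 algebra_simps)

text \<open>The first two terms are the product of the imaginary quaternions \<open>l\<close> and
  \<open>u\<close>; the last one is present only off the horizontal space and accounts for the
  failure of the cross product to be associative.\<close>

lemma \<Phi>_\<Phi>: "\<Phi> l (\<Phi> u v) = - (l \<bullet> u) *\<^sub>R v + \<Phi> (cross3 l u) v + (u \<bullet> E v) *\<^sub>R \<Xi> l"
  by (simp add: \<Phi>_def \<Xi>_def E_def comb_def sum_3 inner_vec_def cross_components \<phi>_simps \<phi>_\<phi>_table S.\<phi>_\<phi>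
      algebra_simps)

text \<open>On the vertical space \<open>\<Phi> l\<close> is the cross product with
  \<open>l\<close>. Together with \<open>E_\<Phi>\<close> and \<open>E_\<Xi>\<close> this splits the
  space into the kernel of \<open>E\<close> and the image of \<open>\<Xi>\<close>, both invariant
  under all \<open>\<Phi> l\<close>.\<close>

lemma \<Phi>_\<Xi>: "\<Phi> l (\<Xi> u) = \<Xi> (cross3 l u)"
  by (simp add: \<Phi>_def \<Xi>_def comb_def sum_3 cross_components \<phi>_simps \<phi>_\<xi>_table S.\<phi>_\<xi> algebra_simps)

lemma E_\<Phi>: "E (\<Phi> l v) = cross3 l (E v)"
  by (simp add: \<Phi>_def E_def comb_def sum_3 vec_eq_iff forall_3 cross_components \<eta>_simps
      \<eta>_\<phi>_table S.\<eta>_\<phi> algebra_simps)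

lemma E_\<Xi>: "E (\<Xi> u) = u"
  by (simp add: \<Xi>_def E_def comb_def sum_3 vec_eq_iff forall_3 \<eta>_simps \<eta>_\<xi>_table S.\<eta>_\<xi>)

lemma g_\<Phi>: "g (\<Phi> l v) w = - g v (\<Phi> l w)"
  by (simp add: \<Phi>_def comb_def sum_3 S.g_simps S.g_\<phi>)

lemma g_\<Xi>: "g v (\<Xi> l) = l \<bullet> E v" "g (\<Xi> l) v = l \<bullet> E v"
proof -
  show "g v (\<Xi> l) = l \<bullet> E v"
    by (simp add: \<Xi>_def E_def comb_def inner_vec_def sum_3 S.g_simps S.g_\<xi>)
  then show "g (\<Xi> l) v = l \<bullet> E v" by (simp add: S.g_sym[of "\<Xi> l"])
qed

text \<open>For equal indices the cross product in \<open>\<Phi>_\<Phi>\<close> disappears, and the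
  unit length of \<open>l\<close> normalises both the square of \<open>\<Phi> l\<close> and the
  value of the form on \<open>\<Xi> l\<close>.\<close>

lemma contact_metric_comb:
  assumes "norm l = 1"
  shows "contact_metric_space (\<Phi> l) (\<Xi> l) (\<lambda>v. l \<bullet> E v) g"
proof (rule contact_metric_space.intro)
  have ll: "l \<bullet> l = 1" using assms by (simp add: norm_eq_1)
  show "linear (\<Phi> l)" by (rule linear_\<Phi>)
  show "linear (\<lambda>v. l \<bullet> E v)" using linear_E by (simp add: linear_iff inner_add_right)
  show "bilinear g" by (rule S.bilinear_g)
  show "g v w = g w v" for v w by (rule S.g_sym)
  show "v \<noteq> 0 \<Longrightarrow> g v v > 0" for v by (rule S.g_pos)
  show \<Phi>2: "\<Phi> l (\<Phi> l v) = - v + (l \<bullet> E v) *\<^sub>R \<Xi> l" for v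
    by (simp add: \<Phi>_\<Phi> ll linear_0[OF \<Phi>_linear_index])
  show "l \<bullet> E (\<Xi> l) = 1" by (simp add: E_\<Xi> ll)
  show "g (\<Phi> l v) (\<Phi> l w) = g v w - l \<bullet> E v * (l \<bullet> E w)" for v w
    by (simp add: g_\<Phi> \<Phi>2 S.g_simps g_\<Xi>)
qed

section \<open>Half turns and the linear maps inducing them\<close>

text \<open>The map \<open>turn n\<close> acts as \<open>\<Phi> n\<close> on the horizontal space \<open>ker E\<close> and on the vertical
  space, the image of \<open>\<Xi>\<close>, as the half turn \<open>half_turn n\<close> about \<open>n\<close>. It pulls the structure of
  index \<open>l\<close> back to that of index \<open>half_turn n l\<close>.\<close>

definition half_turn :: "real ^ 3 \<Rightarrow> real ^ 3 \<Rightarrow> real ^ 3"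
  where "half_turn n a = (2 * (n \<bullet> a)) *\<^sub>R n - a"

definition turn :: "real ^ 3 \<Rightarrow> 'e \<Rightarrow> 'e"
  where "turn n v = \<Phi> n (v - \<Xi> (E v)) + \<Xi> (half_turn n (E v))"

lemma E_turn: "E (turn n v) = half_turn n (E v)"
  by (simp add: turn_def linear_add[OF linear_E] E_\<Phi> linear_diff[OF linear_E] E_\<Xi>)

lemma half_turn_inner: "half_turn n a \<bullet> b = a \<bullet> half_turn n b"
  by (simp add: half_turn_def inner_diff_left inner_diff_right inner_commute)

text \<open>A half turn is a rotation, so it preserves triple products, and it is its own inverse,
  so it can be moved from two of the vectors to the third.\<close>

lemma half_turn_triple:
  assumes "norm n = 1"
  shows "half_turn n a \<bullet> cross3 l (half_turn n b) = a \<bullet> cross3 (half_turn n l) b"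
proof -
  \<comment> \<open>Cramer's rule expressing \<open>n\<close> through \<open>a\<close>,
    \<open>l\<close> and \<open>b\<close>, paired with \<open>n\<close>.\<close>
  have triple: "(n \<bullet> n) * (a \<bullet> cross3 l b) = (n \<bullet> l) * (a \<bullet> cross3 n b) +
      (n \<bullet> a) * (n \<bullet> cross3 l b) + (n \<bullet> b) * (a \<bullet> cross3 l n)"
    by (simp add: inner_vec_def sum_3 cross_components) algebra
  have "n \<bullet> cross3 l n = 0" by (rule dot_cross_self)
  then show ?thesis using triple assms
    by (simp add: half_turn_def cross_mult_left cross_mult_right Cross3.left_diff_distrib
        Cross3.right_diff_distrib inner_diff_left inner_diff_right norm_eq_1 algebra_simps)
qed

text \<open>On the kernel of \<open>E\<close> the inverse of \<open>\<Phi> n\<close> is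
  \<open>- \<Phi> n\<close>. So this is the quaternionic description of a rotation by conjugation,
  for the angle pi.\<close>

lemma \<Phi>_half_turn:
  assumes "E k = 0" "norm n = 1"
  shows "\<Phi> n (\<Phi> l (\<Phi> n k)) = - \<Phi> (half_turn n l) k"
proof -
  have "cross3 n (cross3 l n) = l - (n \<bullet> l) *\<^sub>R n" "n \<bullet> cross3 l n = 0"
    using assms by (simp_all add: Lagrange dot_cross_self norm_eq_1)
  then have "\<Phi> n (\<Phi> l (\<Phi> n k)) = - (n \<bullet> l) *\<^sub>R \<Phi> n k + \<Phi> (l - (n \<bullet> l) *\<^sub>R n) k"
    using assms(1) by (simp add: \<Phi>_\<Phi>[of l n] linear_add[OF linear_\<Phi>] linear_diff[OF linear_\<Phi>] linear_cmul[OF linear_\<Phi>]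
      linear_neg[OF linear_\<Phi>] \<Phi>_\<Phi>[of n "cross3 l n"] inner_commute)
  also have "\<dots> = - \<Phi> (half_turn n l) k"
    using scaleR_add_left[of "n \<bullet> l" "n \<bullet> l" "\<Phi> n k", folded mult_2]
    by (simp add: half_turn_def linear_diff[OF \<Phi>_linear_index] linear_cmul[OF \<Phi>_linear_index])
  finally show ?thesis .
qed

text \<open>The horizontal and vertical parts are orthogonal and invariant, so the two sides split
  accordingly. The horizontal part is \<open>\<Phi>_half_turn\<close> after one use of skewness, the
  vertical part is \<open>half_turn_triple\<close>.\<close>

lemma g_turn:
  assumes n: "norm n = 1"
  shows "g (turn n v) (\<Phi> l (turn n w)) = g v (\<Phi> (half_turn n l) w)"
proof -
  define h k where "h = v - \<Xi> (E v)" and "k = w - \<Xi> (E w)"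
  have E: "E h = 0" "E k = 0" by (simp_all add: h_def k_def linear_diff[OF linear_E] E_\<Xi>)
  have v: "v = h + \<Xi> (E v)" "w = k + \<Xi> (E w)" by (simp_all add: h_def k_def)
  have E0: "E (\<Phi> l k) = 0" if "E k = 0" for l k using that by (simp add: E_\<Phi>)
  have "\<Phi> l (turn n w) = \<Phi> l (\<Phi> n k) + \<Xi> (cross3 l (half_turn n (E w)))"
    by (simp add: turn_def k_def[symmetric] linear_add[OF linear_\<Phi>] \<Phi>_\<Xi>)
  then have "g (turn n v) (\<Phi> l (turn n w)) =
      g (\<Phi> n h) (\<Phi> l (\<Phi> n k)) + half_turn n (E v) \<bullet> cross3 l (half_turn n (E w))"
    by (simp add: turn_def h_def[symmetric] linear_add[OF linear_E] S.g_simps g_\<Xi> E E0 E_\<Xi> inner_commute)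
  also have "g (\<Phi> n h) (\<Phi> l (\<Phi> n k)) = g h (\<Phi> (half_turn n l) k)"
    using \<Phi>_half_turn[OF E(2) n] by (simp add: g_\<Phi> S.g_simps)
  also have "half_turn n (E v) \<bullet> cross3 l (half_turn n (E w)) = E v \<bullet> cross3 (half_turn n l) (E w)"
    by (rule half_turn_triple[OF n])
  also have "g h (\<Phi> (half_turn n l) k) + E v \<bullet> cross3 (half_turn n l) (E w) = g v (\<Phi> (half_turn n l) w)"
  proof -
    have "g (h + \<Xi> (E v)) (\<Phi> (half_turn n l) (k + \<Xi> (E w))) =
        g h (\<Phi> (half_turn n l) k) + E v \<bullet> cross3 (half_turn n l) (E w)"
      by (simp add: linear_add[OF linear_\<Phi>] linear_add[OF linear_E] \<Phi>_\<Xi> S.g_simps g_\<Xi> E E0 E_\<Xi> inner_commute)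
    then show ?thesis using v by simp
  qed
  finally show ?thesis .
qed

text \<open>The axis is the bisector of \<open>l\<close> and \<open>l'\<close>. For opposite points
  there is no bisector, but any axis orthogonal to \<open>l\<close> will do.\<close>

lemma half_turn_exists:
  assumes "norm l = 1" "norm l' = 1"
  obtains n where "norm n = 1" "half_turn n l = l'" "half_turn n l' = l"
proof (cases "l + l' = 0")
  case True
  then have l': "l' = - l" by (simp add: eq_neg_iff_add_eq_0 add.commute)
  obtain n :: "real ^ 3" where "norm n = 1" "orthogonal l n"
  proof -
    obtain y where "y \<noteq> 0" "orthogonal l y"
      using orthogonal_to_vector_exists[of l] by auto
    then show ?thesis
      by (intro that[of "(1 / norm y) *\<^sub>R y"]) (auto simp: orthogonal_def)
  qed
  then show ?thesis
    using l' by (intro that[of n]) (auto simp: half_turn_def orthogonal_def inner_commute)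
next
  case False
  define r where "r = norm (l + l')"
  define n where "n = (1 / r) *\<^sub>R (l + l')"
  \<comment> \<open>By this value of \<open>r * r\<close> the projections of \<open>l\<close> and of
    \<open>l'\<close> to the axis are both \<open>r / 2\<close>, so the doubled projection is
    \<open>l + l'\<close>.\<close>
  have r: "r > 0" "r * r = 2 + 2 * (l \<bullet> l')"
    using False assms by (auto simp: r_def norm_eq_1 inner_add_left inner_add_right inner_commute
        simp flip: power2_eq_square dot_square_norm)
  have "n \<bullet> l = (1 + l \<bullet> l') / r" "n \<bullet> l' = (1 + l \<bullet> l') / r"
    using assms by (auto simp: n_def inner_add_left inner_add_right norm_eq_1 inner_commute add.commute)
  then have "r * (2 * (n \<bullet> l)) = r * r" "r * (2 * (n \<bullet> l')) = r * r" using r by auto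
  then have "2 * (n \<bullet> l) = r" "2 * (n \<bullet> l') = r" using r(1) by auto
  then have "half_turn n l = l'" "half_turn n l' = l"
    using r by (auto simp: half_turn_def n_def)
  moreover have "norm n = 1" using r by (simp add: n_def r_def)
  ultimately show ?thesis using that by blast
qed

section \<open>Independence of the volume form from the point of the sphere\<close>

definition vol :: "nat \<Rightarrow> real ^ 3 \<Rightarrow> (nat \<Rightarrow> 'e) \<Rightarrow> real"
  where "vol m l = wedge 1 (2 * m) (\<lambda>v. l \<bullet> E (v 0)) (wedge_power2 (\<lambda>v w. g v (\<Phi> l w)) m)"

text \<open>Both factors of the wedge are pulled back to the index \<open>half_turn n l\<close>: the
  2-form by \<open>g_turn\<close>, the 1-form because a half turn is self-adjoint.\<close>

lemma vol_turn:
  assumes "norm n = 1"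
  shows "vol m l (\<lambda>i. turn n (v i)) = vol m (half_turn n l) v"
  unfolding vol_def wedge_def
  by (simp only: wedge_power2_pullback[of _ _ "turn n"] g_turn[OF assms] E_turn half_turn_inner)

lemma bilinear_\<Omega>: "bilinear (\<lambda>v w. g v (\<Phi> l w))"
  by (auto simp: bilinear_def linear_iff S.g_simps linear_add[OF linear_\<Phi>] linear_cmul[OF linear_\<Phi>])

lemma multilinear_form_vol: "multilinear_form (2 * m + 1) (vol m l)"
proof -
  have "linear (\<lambda>v. l \<bullet> E v)" using linear_E by (simp add: linear_iff inner_add_right)
  from multilinear_form_wedge[OF linear_multilinear_form_1[OF this] multilinear_form_wedge_power2[OF bilinear_\<Omega>]]
  show ?thesis unfolding vol_def[abs_def] add.commute[of "2 * m" 1] .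
qed

lemma alternating_form_vol: "alternating_form (2 * m + 1) (vol m l)"
  unfolding vol_def[abs_def] add.commute[of "2 * m" 1] by (rule alternating_form_wedge)

lemma vol_basis:
  assumes "norm l = 1" "DIM('e) = 2 * m + 1"
  obtains b where "span (b ` {..<2 * m + 1}) = UNIV" "vol m l b > 0"
proof -
  interpret C: contact_metric_space "\<Phi> l" "\<Xi> l" "\<lambda>v. l \<bullet> E v" g
    by (rule contact_metric_comb[OF assms(1)])
  obtain k b where b: "DIM('e) = 2 * k + 1" "span (b ` {..<2 * k + 1}) = UNIV" "b 0 = \<Xi> l"
    "\<And>i. 1 \<le> i \<Longrightarrow> i < 2 * k + 1 \<Longrightarrow> l \<bullet> E (b i) = 0"
    "symplectic_tuple (\<lambda>v w. g v (\<Phi> l w)) k (\<lambda>i. b (1 + i))"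
    by (rule C.adapted_basis) blast
  have "k = m" using b(1) assms(2) by simp
  moreover have "vol k l b > 0"
    unfolding vol_def using b C.\<eta>_\<xi> by (intro wedge1_wedge_power2_pos) auto
  ultimately show ?thesis using b(2) that by blast
qed

lemma vol_square:
  assumes l: "norm l = 1" "norm l' = 1" and m: "DIM('e) = 2 * m + 1"
  shows "(vol m l v)\<^sup>2 = (vol m l' v)\<^sup>2"
proof -
  obtain n where n: "norm n = 1" "half_turn n l = l'" "half_turn n l' = l"
    using half_turn_exists[OF l] by blast
  obtain b where b: "span (b ` {..<2 * m + 1}) = UNIV" "vol m l b > 0"
    using vol_basis[OF l(1) m] by blast
  define c where "c = vol m l' b / vol m l b"
  have c: "vol m l' w = c * vol m l w" for w
    using alternating_top_forms_proportional[OF multilinear_form_vol[of m l] alternating_form_vol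
        multilinear_form_vol[of m l'] alternating_form_vol b(1), of w] b(2)
    by (simp add: c_def field_simps)
  have "vol m l b = vol m l' (\<lambda>i. turn n (b i))" by (simp add: vol_turn n)
  \<comment> \<open>Proportionality is used at the turned basis, where the form of index
    \<open>l\<close> takes the value that the form of index \<open>l'\<close> has at
    \<open>b\<close>.\<close>
  also have "\<dots> = c * vol m l' b" by (simp add: c vol_turn n)
  also have "\<dots> = c\<^sup>2 * vol m l b" by (simp add: c power2_eq_square)
  finally have "c\<^sup>2 = 1" using b(2) by simp
  then show ?thesis by (simp add: c power_mult_distrib)
qed

text \<open>On a fixed tuple the value is a polynomial in \<open>l\<close>, built by sums and
  products from functions that are linear in \<open>l\<close>.\<close>

lemma continuous_on_vol: "continuous_on A (\<lambda>l. vol m l v)"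
proof -
  have "continuous_on A (\<lambda>l. wedge_power2 (\<lambda>v w. g v (\<Phi> l w)) m v)" for m v
  proof (induction m arbitrary: v)
    case (Suc m)
    have "continuous_on A (\<lambda>l. g x (\<Phi> l y))" for x y
    proof (rule linear_continuous_on, rule linear_conv_bounded_linear[THEN iffD1])
      show "linear (\<lambda>l. g x (\<Phi> l y))"
        using \<Phi>_linear_index[of y] by (auto simp: linear_iff S.g_simps)
    qed
    then show ?case using Suc by (simp add: wedge_def) (intro continuous_intros; simp)
  qed simp
  then show ?thesis unfolding vol_def wedge_def by (intro continuous_intros) auto
qed

lemma vol_const:
  assumes l: "norm l = 1" "norm l' = 1" and m: "DIM('e) = 2 * m + 1"
  shows "vol m l v = vol m l' v"
proof -
  have "connected S2" by (rule connected_sphere) simp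
  \<comment> \<open>By \<open>vol_square\<close> only one value and its negative occur, and a
    continuous function with finite range is constant on a connected set.\<close>
  moreover have "finite ((\<lambda>l. vol m l v) ` S2)"
  proof (rule finite_subset)
    show "(\<lambda>l. vol m l v) ` S2 \<subseteq> {vol m l v, - vol m l v}"
    proof
      fix x assume "x \<in> (\<lambda>l. vol m l v) ` S2"
      then obtain k where "norm k = 1" "x = vol m k v" by auto
      then show "x \<in> {vol m l v, - vol m l v}"
        using vol_square[OF \<open>norm k = 1\<close> l(1) m, of v] by (auto simp: power2_eq_iff)
    qed
  qed simp
  ultimately have "(\<lambda>l. vol m l v) constant_on S2"
    using continuous_on_vol by (intro continuous_finite_range_constant)
  then show ?thesis using l by (auto simp: constant_on_def)
qed

end


section \<open>Smooth functions\<close>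

text \<open>Openness is essential: derivatives at a point of \<open>S\<close> see only values on
  \<open>S\<close> because \<open>S\<close> contains a neighbourhood of it.\<close>

lemma Ck_on_cong:
  assumes "open S" "Ck_on k S f" "\<And>x. x \<in> S \<Longrightarrow> f x = g x"
  shows "Ck_on k S g"
  using assms(2,3)
proof (induction k arbitrary: f g)
  case 0
  then show ?case using continuous_on_cong[of S S f g] by simp
next
  case (Suc k)
  have deriv: "(g has_derivative frechet_derivative f (at x)) (at x)" if "x \<in> S" for x
  proof (rule has_derivative_transform_within_open[OF _ assms(1) that])
    show "(f has_derivative frechet_derivative f (at x)) (at x)"
      using Suc.prems(1) that by (simp add: frechet_derivative_works)
  qed (use Suc.prems(2) in auto)
  have "Ck_on k S (\<lambda>x. frechet_derivative g (at x) v)" for v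
  proof (rule Suc.IH)
    show "Ck_on k S (\<lambda>x. frechet_derivative f (at x) v)" using Suc.prems(1) by simp
    show "frechet_derivative f (at x) v = frechet_derivative g (at x) v" if "x \<in> S" for x
      using frechet_derivative_at[OF deriv[OF that]] by simp
  qed
  then show ?case using deriv by (auto simp: differentiable_def)
qed

lemma Ck_on_Suc_imp: "Ck_on (Suc k) S f \<Longrightarrow> Ck_on k S f"
proof (induction k arbitrary: f)
  case 0
  then show ?case
    by (auto intro!: continuous_at_imp_continuous_on differentiable_imp_continuous_within)
next
  case (Suc k)
  then show ?case by (metis Ck_on.simps(2))
qed

text \<open>Any explicit derivative may stand in for \<open>frechet_derivative\<close>, so the usual
  differentiation rules can drive the inductions below.\<close>

lemma Ck_on_SucI:
  assumes "open S" "\<And>x. x \<in> S \<Longrightarrow> (f has_derivative f' x) (at x)" "\<And>v. Ck_on k S (\<lambda>x. f' x v)"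
  shows "Ck_on (Suc k) S f"
proof -
  have "Ck_on k S (\<lambda>x. frechet_derivative f (at x) v)" for v
    by (rule Ck_on_cong[OF assms(1) assms(3)[of v]]) (simp add: frechet_derivative_at[OF assms(2), symmetric])
  then show ?thesis using assms(2) by (auto simp: differentiable_def)
qed

lemma Ck_on_SucD:
  assumes "Ck_on (Suc k) S f"
  shows "x \<in> S \<Longrightarrow> (f has_derivative frechet_derivative f (at x)) (at x)"
    "Ck_on k S (\<lambda>x. frechet_derivative f (at x) v)"
  using assms by (auto simp: frechet_derivative_works)

lemma Ck_on_const: "open S \<Longrightarrow> Ck_on k S (\<lambda>x. c)"
proof (induction k arbitrary: c)
  case (Suc k)
  then show ?case by (intro Ck_on_SucI[where f' = "\<lambda>x v. 0"]) auto
qed simp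

lemma Ck_on_add: "open S \<Longrightarrow> Ck_on k S f \<Longrightarrow> Ck_on k S g \<Longrightarrow> Ck_on k S (\<lambda>x. f x + g x)"
proof (induction k arbitrary: f g)
  case 0
  then show ?case by (auto intro: continuous_intros)
next
  case (Suc k)
  then show ?case
    by (intro Ck_on_SucI[OF Suc.prems(1) has_derivative_add[OF Ck_on_SucD(1) Ck_on_SucD(1)]] Suc.IH)
      (auto dest: Ck_on_SucD(2) simp del: Ck_on.simps)
qed

lemma (in bounded_linear) Ck_on: "open S \<Longrightarrow> Ck_on k S g \<Longrightarrow> Ck_on k S (\<lambda>x. f (g x))"
proof (induction k arbitrary: g)
  case 0
  then show ?case by (auto intro: continuous_on)
next
  case (Suc k)
  then show ?case
    by (intro Ck_on_SucI[OF Suc.prems(1) has_derivative[OF Ck_on_SucD(1)]] Suc.IH)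
      (auto dest: Ck_on_SucD(2) simp del: Ck_on.simps)
qed

text \<open>By the Leibniz rule the derivative is a sum of two products. Each contains one
  undifferentiated factor, whose class is first lowered by one for the induction hypothesis.\<close>

lemma (in bounded_bilinear) Ck_on:
  "open S \<Longrightarrow> Ck_on k S f \<Longrightarrow> Ck_on k S g \<Longrightarrow> Ck_on k S (\<lambda>x. prod (f x) (g x))"
proof (induction k arbitrary: f g)
  case 0
  then show ?case by (auto intro: continuous_on)
next
  case (Suc k)
  then show ?case
    by (intro Ck_on_SucI[OF Suc.prems(1) FDERIV[OF Ck_on_SucD(1) Ck_on_SucD(1)]] Ck_on_add Suc.IH)
      (auto dest: Ck_on_SucD(2) Ck_on_Suc_imp simp del: Ck_on.simps)
qed

lemma smooth_on_cong: "open S \<Longrightarrow> smooth_on S f \<Longrightarrow> (\<And>x. x \<in> S \<Longrightarrow> f x = g x) \<Longrightarrow> smooth_on S g"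
  unfolding smooth_on_def using Ck_on_cong[of S _ f g] by blast

lemma smooth_on_const: "open S \<Longrightarrow> smooth_on S (\<lambda>x. c)"
  by (simp add: smooth_on_def Ck_on_const)

lemma smooth_on_add: "open S \<Longrightarrow> smooth_on S f \<Longrightarrow> smooth_on S g \<Longrightarrow> smooth_on S (\<lambda>x. f x + g x)"
  by (simp add: smooth_on_def Ck_on_add)

lemma smooth_on_sum:
  "open S \<Longrightarrow> (\<And>i. i \<in> I \<Longrightarrow> smooth_on S (f i)) \<Longrightarrow> smooth_on S (\<lambda>x. \<Sum>i\<in>I. f i x)"
  by (induction I rule: infinite_finite_induct) (auto intro: smooth_on_const smooth_on_add)

lemma smooth_on_scaleR:
  "open S \<Longrightarrow> smooth_on S f \<Longrightarrow> smooth_on S g \<Longrightarrow> smooth_on S (\<lambda>x. f x *\<^sub>R g x)"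
  by (simp add: smooth_on_def bounded_bilinear.Ck_on[OF bounded_bilinear_scaleR])

lemma smooth_on_inner_const: "open S \<Longrightarrow> smooth_on S f \<Longrightarrow> smooth_on S (\<lambda>x. f x \<bullet> c)"
  by (simp add: smooth_on_def bounded_linear.Ck_on[OF bounded_linear_inner_left])

lemma smooth_on_differentiable: "smooth_on S f \<Longrightarrow> x \<in> S \<Longrightarrow> f differentiable at x"
  unfolding smooth_on_def by (metis Ck_on.simps(2))

section \<open>Combinations with coefficients from the sphere\<close>

lemma comb_apply: "comb l F x = comb l (\<lambda>\<alpha>. F \<alpha> x)"
  by (simp add: comb_def sum_3 plus_fun_def scaleR_fun_def)

text \<open>The axis vectors lie on the sphere, so every statement proved for unit \<open>l\<close>
  covers the three original structures as well.\<close>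

lemma comb_axis: "comb (axis i 1) F = F i"
proof -
  have "comb (axis i 1) F = (\<Sum>j\<in>UNIV. if j = i then F j else 0)"
    unfolding comb_def by (intro sum.cong) (auto simp: axis_def)
  then show ?thesis by simp
qed

lemma linear_comb: "linear f \<Longrightarrow> f (comb l F) = comb l (\<lambda>\<alpha>. f (F \<alpha>))"
  by (simp add: comb_def linear_sum linear_scale)

lemma smooth_on_comb:
  assumes "open S" "\<And>\<alpha>. smooth_on S (f \<alpha>)"
  shows "smooth_on S (\<lambda>x. comb l (\<lambda>\<alpha>. f \<alpha> x))"
  unfolding comb_def using assms by (intro smooth_on_sum smooth_on_scaleR smooth_on_const)

section \<open>Tangent spaces in a chart\<close>

locale smooth_mfd =
  fixes M :: "('a, 'e::euclidean_space) manifold"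
  assumes smooth_manifold: "smooth_manifold M"
begin

lemma chart:
  assumes "c \<in> atlas M"
  shows open_chart_img: "open (chart_img c)"
    and inj_on_coords: "inj_on (coords c) (chart_dom c)"
    and openin_chart_dom: "openin (mtop M) (chart_dom c)"
    and open_map_coords: "open_map (subtopology (mtop M) (chart_dom c)) (top_of_set (chart_img c)) (coords c)"
proof -
  have ch: "is_chart (mtop M) c"
    using smooth_manifold assms by (auto simp: smooth_manifold_def)
  then have h: "homeomorphic_map (subtopology (mtop M) (chart_dom c)) (top_of_set (chart_img c)) (coords c)"
    and o: "openin (mtop M) (chart_dom c)"
    by (auto simp: is_chart_def)
  show "open (chart_img c)" using ch by (auto simp: is_chart_def)
  show "openin (mtop M) (chart_dom c)" by (rule o)
  show "open_map (subtopology (mtop M) (chart_dom c)) (top_of_set (chart_img c)) (coords c)"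
    using h by (rule homeomorphic_imp_open_map)
  show "inj_on (coords c) (chart_dom c)"
    using homeomorphic_imp_injective_map[OF h] openin_subset[OF o]
    by (simp add: topspace_subtopology Int_absorb1)
qed

lemma chart_inv_coords: "c \<in> atlas M \<Longrightarrow> p \<in> chart_dom c \<Longrightarrow> chart_inv c (coords c p) = p"
  by (simp add: chart_inv_def inj_on_coords)

lemma coords_chart_inv: "x \<in> chart_img c \<Longrightarrow> coords c (chart_inv c x) = x"
  by (simp add: chart_inv_def chart_img_def f_inv_into_f)

lemma chart_inv_in: "x \<in> chart_img c \<Longrightarrow> chart_inv c x \<in> chart_dom c"
  by (simp add: chart_inv_def chart_img_def inv_into_into)

lemma chart_dom_pts: "c \<in> atlas M \<Longrightarrow> p \<in> chart_dom c \<Longrightarrow> p \<in> pts M"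
  using openin_chart_dom openin_subset by blast

lemma charts_at_iff: "c \<in> charts_at M p \<longleftrightarrow> c \<in> atlas M \<and> p \<in> chart_dom c"
  by (simp add: charts_at_def)

lemma charts_at_chart_inv: "c \<in> atlas M \<Longrightarrow> x \<in> chart_img c \<Longrightarrow> c \<in> charts_at M (chart_inv c x)"
  by (simp add: charts_at_iff chart_inv_in)

lemma coords_in: "p \<in> chart_dom c \<Longrightarrow> coords c p \<in> chart_img c"
  by (simp add: chart_img_def)

lemma charts_at_ex: "p \<in> pts M \<Longrightarrow> \<exists>c. c \<in> charts_at M p"
proof -
  assume "p \<in> pts M"
  then have "p \<in> (\<Union>c\<in>atlas M. chart_dom c)" using smooth_manifold by (simp add: smooth_manifold_def)
  then show ?thesis by (auto simp: charts_at_def)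
qed

lemma open_coords_image:
  assumes "c \<in> atlas M" "openin (mtop M) U" "U \<subseteq> chart_dom c"
  shows "open (coords c ` U)"
proof -
  have "openin (subtopology (mtop M) (chart_dom c)) U"
    using assms by (simp add: openin_open_subtopology openin_chart_dom)
  then have "openin (top_of_set (chart_img c)) (coords c ` U)"
    using open_map_coords[OF assms(1)] by (simp add: open_map_def)
  then show ?thesis using open_chart_img[OF assms(1)] by (simp add: openin_open_eq)
qed

lemma transition_coords: "c \<in> atlas M \<Longrightarrow> q \<in> chart_dom c \<Longrightarrow> transition c c' (coords c q) = coords c' q"
  by (simp add: transition_def chart_inv_coords)

abbreviation dtrans where "dtrans c c' p \<equiv> frechet_derivative (transition c c') (at (coords c p))"

lemma has_derivative_transition:
  assumes "c \<in> charts_at M p" "c' \<in> charts_at M p"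
  shows "(transition c c' has_derivative dtrans c c' p) (at (coords c p))"
proof -
  have "smooth_on (coords c ` (chart_dom c \<inter> chart_dom c')) (transition c c')"
    using smooth_manifold assms by (auto simp: smooth_manifold_def charts_at_iff)
  then have "transition c c' differentiable at (coords c p)"
    by (rule smooth_on_differentiable) (use assms in \<open>auto simp: charts_at_iff\<close>)
  then show ?thesis by (simp add: frechet_derivative_works)
qed

lemma dtrans_refl:
  assumes "c \<in> charts_at M p"
  shows "dtrans c c p u = u"
proof -
  have c: "c \<in> atlas M" "p \<in> chart_dom c" using assms by (auto simp: charts_at_iff)
  have "(transition c c has_derivative id) (at (coords c p))"
  proof (rule has_derivative_transform_within_open[OF _ open_chart_img[OF c(1)] coords_in[OF c(2)]])
    show "((\<lambda>x. x) has_derivative id) (at (coords c p))" by (simp add: id_def)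
    show "x = transition c c x" if "x \<in> chart_img c" for x
      using that by (simp add: transition_def coords_chart_inv)
  qed
  from frechet_derivative_at[OF this] show ?thesis by (metis id_apply)
qed

text \<open>The cocycle identity behind \<open>coord_vec_tangent\<close>: the chain rule on the
  coordinate image of the triple overlap, which is open and on which the transition maps
  compose.\<close>

lemma dtrans_trans:
  assumes c: "c \<in> charts_at M p" "c' \<in> charts_at M p" "c'' \<in> charts_at M p"
  shows "dtrans c c'' p u = dtrans c' c'' p (dtrans c c' p u)"
proof -
  let ?U = "chart_dom c \<inter> chart_dom c' \<inter> chart_dom c''"
  have a: "c \<in> atlas M" "c' \<in> atlas M" "c'' \<in> atlas M" "p \<in> ?U" using c by (auto simp: charts_at_iff)
  have "open (coords c ` ?U)"
    using a by (intro open_coords_image openin_Int openin_chart_dom) auto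
  moreover have "(transition c' c'' \<circ> transition c c' has_derivative dtrans c' c'' p \<circ> dtrans c c' p) (at (coords c p))"
  proof (rule diff_chain_at)
    show "(transition c c' has_derivative dtrans c c' p) (at (coords c p))"
      using c(1,2) by (rule has_derivative_transition)
    show "(transition c' c'' has_derivative dtrans c' c'' p) (at (transition c c' (coords c p)))"
      using has_derivative_transition[OF c(2,3)] a by (simp add: transition_coords)
  qed
  ultimately have "(transition c c'' has_derivative dtrans c' c'' p \<circ> dtrans c c' p) (at (coords c p))"
    using a by (elim has_derivative_transform_within_open) (auto simp: transition_coords)
  from frechet_derivative_at[OF this] show ?thesis by (metis o_apply)
qed

lemma coord_vec_tangent: "c \<in> charts_at M p \<Longrightarrow> coord_vec M c u p \<in> tangent_space M p"
  by (auto simp: tangent_space_def coord_vec_def intro: dtrans_trans)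

lemma coord_vec_self: "c \<in> charts_at M p \<Longrightarrow> coord_vec M c u p c = u"
  by (simp add: coord_vec_def dtrans_refl)

text \<open>A tangent vector is determined by its representation in one chart. With
  \<open>coord_vec_self\<close> this identifies the tangent space with \<open>'e\<close>.\<close>

lemma coord_vec_tangent_eq:
  assumes "c \<in> charts_at M p" "v \<in> tangent_space M p"
  shows "coord_vec M c (v c) p = v"
proof
  fix c'
  have "c' \<in> charts_at M p \<Longrightarrow> v c' = dtrans c c' p (v c)" "c' \<notin> charts_at M p \<Longrightarrow> v c' = 0"
    using assms unfolding tangent_space_def by blast+
  then show "coord_vec M c (v c) p c' = v c'" by (simp add: coord_vec_def)
qed

lemma linear_coord_vec:
  assumes "c \<in> charts_at M p"
  shows "linear (\<lambda>u. coord_vec M c u p)"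
proof -
  have "linear (dtrans c c' p)" if "c' \<in> charts_at M p" for c'
    using has_derivative_transition[OF assms that] has_derivative_linear by blast
  then show ?thesis
    by (auto simp: linear_iff coord_vec_def fun_eq_iff plus_fun_def scaleR_fun_def)
qed

lemma tangent_space_eq_range:
  "c \<in> charts_at M p \<Longrightarrow> tangent_space M p = range (\<lambda>u. coord_vec M c u p)"
  using coord_vec_tangent[of c p] coord_vec_tangent_eq[of c p, symmetric] by blast

lemma subspace_tangent_space: "p \<in> pts M \<Longrightarrow> subspace (tangent_space M p)"
  by (auto dest!: charts_at_ex simp: tangent_space_eq_range
      intro: linear_subspace_image[OF linear_coord_vec subspace_UNIV])

text \<open>Linearity on a tangent space becomes linearity on a whole type, where the general theory
  of linear maps applies.\<close>

lemma tlinear_coord_vec: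
  assumes "c \<in> charts_at M p" "tlinear M p f"
  shows "linear (\<lambda>u. f (coord_vec M c u p))"
proof (rule linearI)
  note L = linear_add[OF linear_coord_vec[OF assms(1)]] linear_cmul[OF linear_coord_vec[OF assms(1)]]
  have *: "f (a *\<^sub>R coord_vec M c u p + b *\<^sub>R coord_vec M c w p)
      = a *\<^sub>R f (coord_vec M c u p) + b *\<^sub>R f (coord_vec M c w p)" for a b u w
    using assms(2) coord_vec_tangent[OF assms(1)] by (simp add: tlinear_def)
  show "f (coord_vec M c (u + w) p) = f (coord_vec M c u p) + f (coord_vec M c w p)" for u w
    using *[of 1 u 1 w] by (simp add: L)
  show "f (coord_vec M c (a *\<^sub>R u) p) = a *\<^sub>R f (coord_vec M c u p)" for a u
    using *[of a u 0 u] by (simp add: L)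
qed

lemma linear_Basis_expand: "linear h \<Longrightarrow> h u = (\<Sum>b\<in>Basis. (u \<bullet> b) *\<^sub>R h b)" for u :: 'e
  by (subst euclidean_representation[of u, symmetric]) (simp only: linear_sum linear_scale)

lemma tlinear_expand:
  assumes "c \<in> charts_at M p" "tlinear M p f" "v \<in> tangent_space M p"
  shows "f v = (\<Sum>b\<in>Basis. (v c \<bullet> b) *\<^sub>R f (coord_vec M c b p))"
  using linear_Basis_expand[OF tlinear_coord_vec[OF assms(1,2)], of "v c"]
    coord_vec_tangent_eq[OF assms(1,3)] by simp

text \<open>Sections defined on a chart domain only, such as the images of coordinate vector fields under
  a tensor field, are needed besides vector fields.\<close>

definition smooth_section :: "('a, 'e) chart \<Rightarrow> ('a, 'e) vfield \<Rightarrow> bool"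
  where "smooth_section c Y \<longleftrightarrow> (\<forall>p\<in>chart_dom c. Y p \<in> tangent_space M p) \<and>
    smooth_on (chart_img c) (\<lambda>x. Y (chart_inv c x) c)"

lemma vector_field_smooth_section: "vector_field M X \<Longrightarrow> c \<in> atlas M \<Longrightarrow> smooth_section c X"
  using chart_dom_pts by (auto simp: vector_field_def smooth_section_def)

lemma smooth_section_coord_vec:
  assumes "c \<in> atlas M"
  shows "smooth_section c (\<lambda>p. coord_vec M c u p)"
  unfolding smooth_section_def
proof
  show "smooth_on (chart_img c) (\<lambda>x. coord_vec M c u (chart_inv c x) c)"
    using smooth_on_const[OF open_chart_img[OF assms], of u]
    by (rule smooth_on_cong[OF open_chart_img[OF assms]])
      (simp add: coord_vec_self charts_at_chart_inv assms)
qed (use assms in \<open>auto intro: coord_vec_tangent simp: charts_at_iff\<close>)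

text \<open>Smoothness of a form is defined through coordinate fields alone. Expanding a section in
  them passes to arbitrary sections, with the coordinates of the section as smooth
  coefficients.\<close>

lemma smooth_on_one_form:
  assumes "one_form M \<eta>" "c \<in> atlas M" "smooth_section c Y"
  shows "smooth_on (chart_img c) (\<lambda>x. \<eta> (chart_inv c x) (Y (chart_inv c x)))"
proof (rule smooth_on_cong[OF open_chart_img[OF assms(2)]])
  show "smooth_on (chart_img c) (\<lambda>x. \<Sum>b\<in>Basis. (Y (chart_inv c x) c \<bullet> b) *\<^sub>R
      \<eta> (chart_inv c x) (coord_vec M c b (chart_inv c x)))"
    using assms
    by (intro smooth_on_sum smooth_on_scaleR smooth_on_inner_const open_chart_img)
      (auto simp: one_form_def smooth_section_def)
  fix x assume x: "x \<in> chart_img c"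
  show "(\<Sum>b\<in>Basis. (Y (chart_inv c x) c \<bullet> b) *\<^sub>R
      \<eta> (chart_inv c x) (coord_vec M c b (chart_inv c x))) = \<eta> (chart_inv c x) (Y (chart_inv c x))"
    using assms x chart_dom_pts[OF assms(2) chart_inv_in[OF x]] chart_inv_in[OF x]
    by (intro tlinear_expand[symmetric] charts_at_chart_inv) (auto simp: one_form_def smooth_section_def)
qed

text \<open>Besides vector fields, this serves the fundamental forms, where the second section is
  the image of a coordinate field under \<phi>.\<close>

lemma smooth_on_tensor02:
  assumes "tensor02_field M B" "c \<in> atlas M" "smooth_section c Y" "smooth_section c Z"
  shows "smooth_on (chart_img c) (\<lambda>x. B (chart_inv c x) (Y (chart_inv c x)) (Z (chart_inv c x)))"
proof (rule smooth_on_cong[OF open_chart_img[OF assms(2)]])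
  show "smooth_on (chart_img c) (\<lambda>x. \<Sum>b\<in>Basis. (Y (chart_inv c x) c \<bullet> b) *\<^sub>R
      (\<Sum>d\<in>Basis. (Z (chart_inv c x) c \<bullet> d) *\<^sub>R
        B (chart_inv c x) (coord_vec M c b (chart_inv c x)) (coord_vec M c d (chart_inv c x))))"
    using assms
    by (intro smooth_on_sum smooth_on_scaleR smooth_on_inner_const open_chart_img)
      (auto simp: tensor02_field_def smooth_section_def)
  fix x assume x: "x \<in> chart_img c"
  define p where "p = chart_inv c x"
  have c: "c \<in> charts_at M p" and p: "p \<in> pts M" and YZ: "Y p \<in> tangent_space M p" "Z p \<in> tangent_space M p"
    using charts_at_chart_inv[OF assms(2) x] chart_dom_pts[OF assms(2) chart_inv_in[OF x]]
      chart_inv_in[OF x] assms(3,4) by (auto simp: p_def smooth_section_def)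
  have B: "tlinear M p (B p u)" "tlinear M p (\<lambda>v. B p v u)" if "u \<in> tangent_space M p" for u
    using assms(1) p that by (auto simp: tensor02_field_def tbilinear_def)
  have "B p (Y p) (Z p) = (\<Sum>b\<in>Basis. (Y p c \<bullet> b) *\<^sub>R B p (coord_vec M c b p) (Z p))"
    by (rule tlinear_expand[OF c B(2) YZ(1)]) (rule YZ(2))
  also have "\<dots> = (\<Sum>b\<in>Basis. (Y p c \<bullet> b) *\<^sub>R
      (\<Sum>d\<in>Basis. (Z p c \<bullet> d) *\<^sub>R B p (coord_vec M c b p) (coord_vec M c d p)))"
    using tlinear_expand[OF c B(1) YZ(2)] coord_vec_tangent[OF c] by simp
  finally show "(\<Sum>b\<in>Basis. (Y (chart_inv c x) c \<bullet> b) *\<^sub>R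
      (\<Sum>d\<in>Basis. (Z (chart_inv c x) c \<bullet> d) *\<^sub>R
        B (chart_inv c x) (coord_vec M c b (chart_inv c x)) (coord_vec M c d (chart_inv c x)))) =
      B (chart_inv c x) (Y (chart_inv c x)) (Z (chart_inv c x))"
    by (simp add: p_def)
qed

lemma smooth_section_tensor11:
  assumes "tensor11_field M \<phi>" "c \<in> atlas M"
  shows "smooth_section c (\<lambda>p. \<phi> p (coord_vec M c u p))"
  using assms chart_dom_pts[OF assms(2)] coord_vec_tangent[of c]
  by (fastforce simp: smooth_section_def tensor11_field_def charts_at_iff)

section \<open>Combinations of forms and their exterior derivatives\<close>

lemma tlinear_comb: "(\<And>\<alpha>. tlinear M p (f \<alpha>)) \<Longrightarrow> tlinear M p (\<lambda>v. comb l (\<lambda>\<alpha>. f \<alpha> v))"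
  by (simp add: tlinear_def comb_def sum_3 algebra_simps)

lemma one_form_comb:
  assumes "\<And>\<alpha>. one_form M (\<eta> \<alpha>)"
  shows "one_form M (comb l \<eta>)"
  unfolding one_form_def comb_apply[abs_def]
  using assms by (auto simp: one_form_def comb_apply intro!: tlinear_comb smooth_on_comb open_chart_img)

lemma tensor02_field_comb:
  assumes "\<And>\<alpha>. tensor02_field M (B \<alpha>)"
  shows "tensor02_field M (comb l B)"
  using assms
  by (auto simp: tensor02_field_def tbilinear_def comb_apply comb_apply[abs_def]
      intro!: tlinear_comb smooth_on_comb open_chart_img)

lemma two_form_comb:
  assumes "\<And>\<alpha>. two_form M (B \<alpha>)"
  shows "two_form M (comb l B)"
  unfolding two_form_def
proof
  show "tensor02_field M (comb l B)" using assms by (intro tensor02_field_comb) (auto simp: two_form_def)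
  show "\<forall>p\<in>pts M. \<forall>v\<in>tangent_space M p. comb l B p v v = 0"
    using assms by (simp add: two_form_def comb_apply) (simp add: comb_def)
qed

lemma vector_field_comb:
  assumes "\<And>\<alpha>. vector_field M (\<xi> \<alpha>)"
  shows "vector_field M (comb l \<xi>)"
  unfolding vector_field_def
proof (intro conjI ballI allI impI)
  fix p assume "p \<in> pts M"
  then show "comb l \<xi> p \<in> tangent_space M p"
    using assms subspace_tangent_space[of p]
    by (subst comb_apply) (auto simp: comb_def vector_field_def intro!: subspace_sum subspace_scale)
next
  fix p assume "p \<notin> pts M"
  then show "comb l \<xi> p = 0" using assms by (simp add: comb_apply vector_field_def) (simp add: comb_def)
next
  fix c assume "c \<in> atlas M"
  then show "smooth_on (chart_img c) (\<lambda>x. comb l \<xi> (chart_inv c x) c)"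
    using assms by (auto simp: comb_apply vector_field_def intro!: smooth_on_comb open_chart_img)
qed

text \<open>Derivatives are additive only on differentiable functions. As \<open>vderiv\<close>
  selects some chart by choice, smoothness is asked for in all charts.\<close>

lemma vderiv_comb:
  assumes "\<And>\<alpha> c. c \<in> atlas M \<Longrightarrow> smooth_on (chart_img c) (\<lambda>x. f \<alpha> (chart_inv c x))" "p \<in> pts M"
  shows "vderiv M X (\<lambda>q. comb l (\<lambda>\<alpha>. f \<alpha> q)) p = comb l (\<lambda>\<alpha>. vderiv M X (f \<alpha>) p)"
proof -
  define c where "c = (SOME c. c \<in> charts_at M p)"
  have "c \<in> charts_at M p" unfolding c_def using charts_at_ex[OF assms(2)] by (rule someI_ex)
  then have c: "c \<in> atlas M" "p \<in> chart_dom c" by (auto simp: charts_at_iff)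
  have d: "(f \<alpha> \<circ> chart_inv c has_derivative frechet_derivative (f \<alpha> \<circ> chart_inv c) (at (coords c p)))
      (at (coords c p))" for \<alpha>
    using smooth_on_differentiable[OF assms(1)[OF c(1)] coords_in[OF c(2)]]
    by (simp add: frechet_derivative_works o_def)
  have "((\<lambda>x. comb l (\<lambda>\<alpha>. (f \<alpha> \<circ> chart_inv c) x)) has_derivative
      (\<lambda>v. comb l (\<lambda>\<alpha>. frechet_derivative (f \<alpha> \<circ> chart_inv c) (at (coords c p)) v))) (at (coords c p))"
    unfolding comb_def by (intro has_derivative_sum has_derivative_scaleR_right d)
  from frechet_derivative_at[OF this] show ?thesis
    by (simp add: vderiv_def Let_def c_def[symmetric] o_def) metis
qed

text \<open>The Lie bracket does not involve the form, so the exterior derivative is linear in it as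
  soon as the derivatives of its values on vector fields are.\<close>

lemma closed1_comb:
  assumes "\<And>\<alpha>. one_form M (\<eta> \<alpha>)" "\<And>\<alpha>. closed1 M (\<eta> \<alpha>)"
  shows "closed1 M (comb l \<eta>)"
  unfolding closed1_def
proof (intro allI impI ballI)
  fix X Y p assume X: "vector_field M X" and Y: "vector_field M Y" and p: "p \<in> pts M"
  have vd: "vderiv M U (capply1 (comb l \<eta>) V) p = comb l (\<lambda>\<alpha>. vderiv M U (capply1 (\<eta> \<alpha>) V) p)"
    if "vector_field M V" for U V
    unfolding capply1_def comb_apply using assms(1) p that
    by (intro vderiv_comb smooth_on_one_form vector_field_smooth_section)
  have "ext_deriv1 M (comb l \<eta>) X Y p = comb l (\<lambda>\<alpha>. ext_deriv1 M (\<eta> \<alpha>) X Y p)"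
    by (simp add: ext_deriv1_def vd X Y comb_apply) (simp add: comb_def sum_3 algebra_simps)
  then show "ext_deriv1 M (comb l \<eta>) X Y p = 0"
    using assms(2) X Y p by (simp add: closed1_def comb_def)
qed

lemma closed2_comb:
  assumes "\<And>\<alpha>. two_form M (\<Omega> \<alpha>)" "\<And>\<alpha>. closed2 M (\<Omega> \<alpha>)"
  shows "closed2 M (comb l \<Omega>)"
  unfolding closed2_def
proof (intro allI impI ballI)
  fix X Y Z p
  assume X: "vector_field M X" and Y: "vector_field M Y" and Z: "vector_field M Z" and p: "p \<in> pts M"
  have vd: "vderiv M U (capply2 (comb l \<Omega>) V W) p = comb l (\<lambda>\<alpha>. vderiv M U (capply2 (\<Omega> \<alpha>) V W) p)"
    if "vector_field M V" "vector_field M W" for U V W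
    unfolding capply2_def comb_apply using assms(1) p that
    by (intro vderiv_comb smooth_on_tensor02 vector_field_smooth_section) (auto simp: two_form_def)
  have "ext_deriv2 M (comb l \<Omega>) X Y Z p = comb l (\<lambda>\<alpha>. ext_deriv2 M (\<Omega> \<alpha>) X Y Z p)"
    by (simp add: ext_deriv2_def vd X Y Z comb_apply) (simp add: comb_def sum_3 algebra_simps)
  then show "ext_deriv2 M (comb l \<Omega>) X Y Z p = 0"
    using assms(2) X Y Z p by (simp add: closed2_def comb_def)
qed

end


section \<open>The sphere of a 3-cosymplectic manifold\<close>

locale three_cosymplectic_mfd = smooth_mfd M
  for M :: "('a, 'e::euclidean_space) manifold" +
  fixes \<phi> :: "3 \<Rightarrow> ('a, 'e) tensor11" and \<xi> :: "3 \<Rightarrow> ('a, 'e) vfield"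
    and \<eta> :: "3 \<Rightarrow> ('a, 'e) form1" and g :: "('a, 'e) tensor02"
  assumes three_cosymplectic: "three_cosymplectic M \<phi> \<xi> \<eta> g"
begin

definition \<Omega> :: "3 \<Rightarrow> ('a, 'e) tensor02" where "\<Omega> \<alpha> = fundamental_form (\<phi> \<alpha>) g"

lemma three_cosymplectic_structure:
  shows riemannian: "riemannian_metric M g"
    and contact: "almost_contact M (\<phi> \<alpha>) (\<xi> \<alpha>) (\<eta> \<alpha>)"
    and compatible: "compatible_metric M (\<phi> \<alpha>) (\<eta> \<alpha>) g"
    and closed1_\<eta>: "closed1 M (\<eta> \<alpha>)"
    and closed2_\<Omega>: "closed2 M (\<Omega> \<alpha>)"
  using three_cosymplectic by (auto simp: three_cosymplectic_def almost_contact_metric_3_def \<Omega>_def)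

lemma cyclic:
  assumes "(\<alpha>, \<beta>, \<gamma>) \<in> {(1, 2, 3), (2, 3, 1), (3, 1, 2)}" "p \<in> pts M"
  shows "v \<in> tangent_space M p \<Longrightarrow>
      \<phi> \<gamma> p v = \<phi> \<alpha> p (\<phi> \<beta> p v) - \<eta> \<beta> p v *\<^sub>R \<xi> \<alpha> p \<and>
      \<phi> \<gamma> p v = - \<phi> \<beta> p (\<phi> \<alpha> p v) + \<eta> \<alpha> p v *\<^sub>R \<xi> \<beta> p \<and>
      \<eta> \<gamma> p v = \<eta> \<alpha> p (\<phi> \<beta> p v) \<and> \<eta> \<gamma> p v = - \<eta> \<beta> p (\<phi> \<alpha> p v)"
    "\<xi> \<gamma> p = \<phi> \<alpha> p (\<xi> \<beta> p)" "\<xi> \<gamma> p = - \<phi> \<beta> p (\<xi> \<alpha> p)"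
proof -
  have "\<forall>(\<alpha>, \<beta>, \<gamma>) \<in> {(1, 2, 3), (2, 3, 1), (3, 1, 2)}. \<forall>p\<in>pts M.
       (\<forall>v\<in>tangent_space M p.
          \<phi> \<gamma> p v = \<phi> \<alpha> p (\<phi> \<beta> p v) - \<eta> \<beta> p v *\<^sub>R \<xi> \<alpha> p \<and>
          \<phi> \<gamma> p v = - \<phi> \<beta> p (\<phi> \<alpha> p v) + \<eta> \<alpha> p v *\<^sub>R \<xi> \<beta> p \<and>
          \<eta> \<gamma> p v = \<eta> \<alpha> p (\<phi> \<beta> p v) \<and> \<eta> \<gamma> p v = - \<eta> \<beta> p (\<phi> \<alpha> p v)) \<and>
       \<xi> \<gamma> p = \<phi> \<alpha> p (\<xi> \<beta> p) \<and> \<xi> \<gamma> p = - \<phi> \<beta> p (\<xi> \<alpha> p)"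
    using three_cosymplectic unfolding three_cosymplectic_def almost_contact_metric_3_def by blast
  from bspec[OF bspec[OF this assms(1), unfolded prod.case] assms(2)]
  show "v \<in> tangent_space M p \<Longrightarrow>
      \<phi> \<gamma> p v = \<phi> \<alpha> p (\<phi> \<beta> p v) - \<eta> \<beta> p v *\<^sub>R \<xi> \<alpha> p \<and>
      \<phi> \<gamma> p v = - \<phi> \<beta> p (\<phi> \<alpha> p v) + \<eta> \<alpha> p v *\<^sub>R \<xi> \<beta> p \<and>
      \<eta> \<gamma> p v = \<eta> \<alpha> p (\<phi> \<beta> p v) \<and> \<eta> \<gamma> p v = - \<eta> \<beta> p (\<phi> \<alpha> p v)"
    "\<xi> \<gamma> p = \<phi> \<alpha> p (\<xi> \<beta> p)" "\<xi> \<gamma> p = - \<phi> \<beta> p (\<xi> \<alpha> p)" by blast+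
qed

lemma fields:
  shows one_form_\<eta>: "one_form M (\<eta> \<alpha>)" and vector_field_\<xi>: "vector_field M (\<xi> \<alpha>)"
    and tensor11_\<phi>: "tensor11_field M (\<phi> \<alpha>)" and tensor02_g: "tensor02_field M g"
  using contact[of \<alpha>] riemannian by (auto simp: almost_contact_def riemannian_metric_def)

end

text \<open>A point and a chart around it are fixed. The map \<open>L\<close> identifies
  \<open>'e\<close> with the tangent space, and the constants prefixed by \<open>h\<close> are the
  structure at \<open>p\<close> read in this chart.\<close>

locale three_cosymplectic_chart = three_cosymplectic_mfd M \<phi> \<xi> \<eta> g
  for M :: "('a, 'e::euclidean_space) manifold" and \<phi> \<xi> \<eta> g +
  fixes p :: 'a and c :: "('a, 'e) chart"
  assumes c: "c \<in> charts_at M p"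
begin

abbreviation T where "T \<equiv> tangent_space M p"

definition L :: "'e \<Rightarrow> ('a, 'e) tvec" where "L u = coord_vec M c u p"

lemma p: "p \<in> pts M" using c chart_dom_pts[of c p] by (simp add: charts_at_iff)

lemma linear_L: "linear L"
  using linear_coord_vec[OF c] by (simp add: L_def[abs_def])

lemma L_T: "L u \<in> T" using coord_vec_tangent[OF c] by (simp add: L_def)

lemma L_c: "L u c = u" using coord_vec_self[OF c] by (simp add: L_def)

lemma L_eq: "v \<in> T \<Longrightarrow> L (v c) = v" using coord_vec_tangent_eq[OF c] by (simp add: L_def)

lemma \<phi>_T: "v \<in> T \<Longrightarrow> \<phi> \<alpha> p v \<in> T"
  using tensor11_\<phi>[of \<alpha>] p by (auto simp: tensor11_field_def)

lemma \<xi>_T: "\<xi> \<alpha> p \<in> T"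
  using vector_field_\<xi>[of \<alpha>] p by (auto simp: vector_field_def)

definition h\<phi> where "h\<phi> \<alpha> u = \<phi> \<alpha> p (L u) c"
definition h\<xi> where "h\<xi> \<alpha> = \<xi> \<alpha> p c"
definition h\<eta> where "h\<eta> \<alpha> u = \<eta> \<alpha> p (L u)"
definition hg where "hg u w = g p (L u) (L w)"

lemma L_h\<phi>: "L (h\<phi> \<alpha> u) = \<phi> \<alpha> p (L u)" by (simp add: h\<phi>_def L_eq \<phi>_T L_T)
lemma L_h\<xi>: "L (h\<xi> \<alpha>) = \<xi> \<alpha> p" by (simp add: h\<xi>_def L_eq \<xi>_T)

lemma L_inject: "L u = L w \<longleftrightarrow> u = w" using L_c by metis

lemma linear_tlinear: "tlinear M p f \<Longrightarrow> linear (\<lambda>u. f (L u))"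
  using tlinear_coord_vec[OF c] by (simp add: L_def)

lemmas L_simps = linear_add[OF linear_L] linear_diff[OF linear_L] linear_neg[OF linear_L]
  linear_cmul[OF linear_L]

text \<open>Equations between vectors are checked after applying the injective map \<open>L\<close>,
  where they become the given equations in the tangent space.\<close>

sublocale H: contact_metric_3_space h\<phi> h\<xi> h\<eta> hg
proof (rule contact_metric_3_space.intro)
  fix \<alpha>
  show "contact_metric_space (h\<phi> \<alpha>) (h\<xi> \<alpha>) (h\<eta> \<alpha>) hg"
  proof (rule contact_metric_space.intro)
    have "linear (\<lambda>u. \<phi> \<alpha> p (L u))"
      using tensor11_\<phi>[of \<alpha>] p by (auto simp: tensor11_field_def intro: linear_tlinear)
    then show "linear (h\<phi> \<alpha>)"
      by (auto simp: linear_iff h\<phi>_def plus_fun_def scaleR_fun_def)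
    show "linear (h\<eta> \<alpha>)"
      unfolding h\<eta>_def[abs_def] using one_form_\<eta>[of \<alpha>] p by (auto simp: one_form_def intro: linear_tlinear)
    have "tlinear M p (g p (L u))" "tlinear M p (\<lambda>v. g p v (L u))" for u
      using tensor02_g p L_T by (auto simp: tensor02_field_def tbilinear_def)
    then show "bilinear hg"
      unfolding bilinear_def hg_def[abs_def] using linear_tlinear by auto
    show "hg v w = hg w v" for v w
      using riemannian p L_T by (auto simp: hg_def riemannian_metric_def)
    show "hg v v > 0" if "v \<noteq> 0" for v
    proof -
      have "L v \<noteq> 0" using that L_inject[of v 0] linear_0[OF linear_L] by simp
      then show ?thesis using riemannian p L_T by (auto simp: hg_def riemannian_metric_def)
    qed
    show "h\<phi> \<alpha> (h\<phi> \<alpha> v) = - v + h\<eta> \<alpha> v *\<^sub>R h\<xi> \<alpha>" for v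
    proof -
      have "\<phi> \<alpha> p (\<phi> \<alpha> p (L v)) = - L v + \<eta> \<alpha> p (L v) *\<^sub>R \<xi> \<alpha> p"
        using contact[of \<alpha>] p L_T unfolding almost_contact_def by blast
      then have "L (h\<phi> \<alpha> (h\<phi> \<alpha> v)) = L (- v + h\<eta> \<alpha> v *\<^sub>R h\<xi> \<alpha>)"
        by (simp only: L_h\<phi> L_simps L_h\<xi> h\<eta>_def)
      then show ?thesis by (simp only: L_inject)
    qed
    show "h\<eta> \<alpha> (h\<xi> \<alpha>) = 1"
      using contact[of \<alpha>] p by (auto simp: h\<eta>_def L_h\<xi> almost_contact_def)
    show "hg (h\<phi> \<alpha> v) (h\<phi> \<alpha> w) = hg v w - h\<eta> \<alpha> v * h\<eta> \<alpha> w" for v w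
      using compatible[of \<alpha>] p L_T by (auto simp: hg_def h\<eta>_def L_h\<phi> compatible_metric_def)
  qed
next
  fix \<alpha> \<beta> \<gamma> :: 3 and v assume cyc: "(\<alpha>, \<beta>, \<gamma>) \<in> {(1, 2, 3), (2, 3, 1), (3, 1, 2)}"
  note cy = cyclic(1)[OF cyc p L_T[of v]] cyclic(2,3)[OF cyc p]
  have "L (h\<phi> \<gamma> v) = L (h\<phi> \<alpha> (h\<phi> \<beta> v) - h\<eta> \<beta> v *\<^sub>R h\<xi> \<alpha>)"
    "L (h\<phi> \<gamma> v) = L (- h\<phi> \<beta> (h\<phi> \<alpha> v) + h\<eta> \<alpha> v *\<^sub>R h\<xi> \<beta>)"
    "h\<eta> \<gamma> v = h\<eta> \<alpha> (h\<phi> \<beta> v)" "h\<eta> \<gamma> v = - h\<eta> \<beta> (h\<phi> \<alpha> v)"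
    "L (h\<xi> \<gamma>) = L (h\<phi> \<alpha> (h\<xi> \<beta>))" "L (h\<xi> \<gamma>) = L (- h\<phi> \<beta> (h\<xi> \<alpha>))"
    unfolding L_simps L_h\<phi> L_h\<xi> h\<eta>_def using cy by blast+
  then show "h\<phi> \<gamma> v = h\<phi> \<alpha> (h\<phi> \<beta> v) - h\<eta> \<beta> v *\<^sub>R h\<xi> \<alpha> \<and>
       h\<phi> \<gamma> v = - h\<phi> \<beta> (h\<phi> \<alpha> v) + h\<eta> \<alpha> v *\<^sub>R h\<xi> \<beta> \<and>
       h\<eta> \<gamma> v = h\<eta> \<alpha> (h\<phi> \<beta> v) \<and> h\<eta> \<gamma> v = - h\<eta> \<beta> (h\<phi> \<alpha> v) \<and>
       h\<xi> \<gamma> = h\<phi> \<alpha> (h\<xi> \<beta>) \<and> h\<xi> \<gamma> = - h\<phi> \<beta> (h\<xi> \<alpha>)"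
    unfolding L_inject by blast
qed

lemma \<eta>_comb_L: "comb l \<eta> p (L u) = l \<bullet> H.E u"
  by (simp add: comb_apply) (simp add: comb_def H.E_def h\<eta>_def inner_vec_def)

lemma \<Omega>_L: "\<Omega> \<alpha> p (L u) (L w) = hg u (h\<phi> \<alpha> w)"
  by (simp add: \<Omega>_def fundamental_form_def hg_def L_h\<phi>)

lemma linear_hg: "linear (hg u)"
  using H.S.bilinear_g by (simp add: bilinear_def)

lemma \<Omega>_comb_L: "comb l \<Omega> p (L u) (L w) = hg u (H.\<Phi> l w)"
  by (simp add: comb_apply \<Omega>_L H.\<Phi>_def linear_comb[OF linear_hg])

lemma \<xi>_comb: "comb l \<xi> p = L (H.\<Xi> l)"
  by (simp add: comb_apply H.\<Xi>_def linear_comb[OF linear_L] L_h\<xi>)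

text \<open>A tuple of tangent vectors is the \<open>L\<close>-image of its coordinates, and
  pullback along \<open>L\<close> turns the forms into those of the coordinate space.\<close>

lemma eta_wedge_Omega_comb:
  assumes "\<And>i. v i \<in> T"
  shows "eta_wedge_Omega m (comb l \<eta>) (comb l \<Omega>) p v = H.vol m l (\<lambda>i. v i c)"
proof -
  have v: "v = (\<lambda>i. L (v i c))" using assms L_eq by auto
  show ?thesis
    apply (subst v)
    unfolding eta_wedge_Omega_def H.vol_def wedge_def
    by (simp only: wedge_power2_pullback[of _ _ L] \<eta>_comb_L \<Omega>_comb_L)
qed

lemma reeb_comb:
  assumes "norm l = 1"
  shows "comb l \<eta> p (comb l \<xi> p) = 1" "v \<in> T \<Longrightarrow> comb l \<Omega> p (comb l \<xi> p) v = 0"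
    "z \<in> T \<Longrightarrow> comb l \<eta> p z = 1 \<Longrightarrow> (\<And>v. v \<in> T \<Longrightarrow> comb l \<Omega> p z v = 0) \<Longrightarrow> z = comb l \<xi> p"
proof -
  interpret C: contact_metric_space "H.\<Phi> l" "H.\<Xi> l" "\<lambda>v. l \<bullet> H.E v" hg
    by (rule H.contact_metric_comb[OF assms])
  show "comb l \<eta> p (comb l \<xi> p) = 1" by (simp add: \<xi>_comb \<eta>_comb_L C.\<eta>_\<xi>)
  show "comb l \<Omega> p (comb l \<xi> p) v = 0" if "v \<in> T"
  proof -
    have "comb l \<Omega> p (comb l \<xi> p) (L (v c)) = 0"
      using C.g_\<phi>[of "H.\<Xi> l" "v c"] by (simp add: \<xi>_comb \<Omega>_comb_L C.\<phi>_\<xi> C.g_simps)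
    then show ?thesis using L_eq[OF that] by simp
  qed
  assume z: "z \<in> T" "comb l \<eta> p z = 1" "\<And>v. v \<in> T \<Longrightarrow> comb l \<Omega> p z v = 0"
  have "z c = H.\<Xi> l"
  proof (rule C.reeb_unique)
    show "l \<bullet> H.E (z c) = 1" using z(2) by (simp flip: \<eta>_comb_L add: L_eq z(1))
    show "hg (z c) (H.\<Phi> l v) = 0" for v
      using z(3)[OF L_T[of v]] by (simp flip: \<Omega>_comb_L add: L_eq z(1))
  qed
  then show "z = comb l \<xi> p" using L_eq[OF z(1)] by (simp add: \<xi>_comb)
qed

lemma \<Omega>_bilinear_alternating:
  "tbilinear M p (\<Omega> \<alpha> p)" "v \<in> T \<Longrightarrow> \<Omega> \<alpha> p v v = 0"
proof -
  have g: "tlinear M p (g p u)" "tlinear M p (\<lambda>v. g p v u)" if "u \<in> T" for u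
    using tensor02_g p that by (auto simp: tensor02_field_def tbilinear_def)
  have "tlinear M p (\<phi> \<alpha> p)" using tensor11_\<phi>[of \<alpha>] p by (auto simp: tensor11_field_def)
  then show "tbilinear M p (\<Omega> \<alpha> p)"
    using g \<phi>_T by (simp add: tbilinear_def \<Omega>_def fundamental_form_def tlinear_def)
  assume v: "v \<in> T"
  \<comment> \<open>Skewness of \<phi> and symmetry of the metric make this number its own
    negative.\<close>
  have "hg (v c) (h\<phi> \<alpha> (v c)) = 0"
    using H.S.g_\<phi>[of \<alpha> "v c" "v c"] H.S.g_sym[of "v c"] by simp
  then show "\<Omega> \<alpha> p v v = 0" by (simp flip: \<Omega>_L add: L_eq v)
qed

lemma dim_odd: "odd DIM('e)"
  using H.S.adapted_basis by (metis odd_two_times_div_two_succ even_plus_one_iff dvd_triv_left)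

end

section \<open>From single points to the whole manifold\<close>

context three_cosymplectic_mfd
begin

lemma chart_locale: "c \<in> charts_at M p \<Longrightarrow> three_cosymplectic_chart M \<phi> \<xi> \<eta> g p c"
  by unfold_locales

lemma two_form_\<Omega>: "two_form M (\<Omega> \<alpha>)"
proof -
  have pt: "tbilinear M p (\<Omega> \<alpha> p) \<and> (\<forall>v\<in>tangent_space M p. \<Omega> \<alpha> p v v = 0)" if p: "p \<in> pts M" for p
  proof -
    obtain c where "c \<in> charts_at M p" using charts_at_ex[OF p] by blast
    then interpret three_cosymplectic_chart M \<phi> \<xi> \<eta> g p c by (rule chart_locale)
    show ?thesis using \<Omega>_bilinear_alternating by blast
  qed
  have "smooth_on (chart_img c) (\<lambda>x. \<Omega> \<alpha> (chart_inv c x)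
      (coord_vec M c u (chart_inv c x)) (coord_vec M c w (chart_inv c x)))"
    if "c \<in> atlas M" for c u w
    unfolding \<Omega>_def fundamental_form_def
    by (rule smooth_on_tensor02[OF tensor02_g that smooth_section_coord_vec[OF that]
          smooth_section_tensor11[OF tensor11_\<phi> that]])
  then show ?thesis using pt by (simp add: two_form_def tensor02_field_def)
qed

text \<open>The parity of the dimension is read off at a single point, which exists because
  manifolds are nonempty.\<close>

lemma dim: "DIM('e) = 2 * (DIM('e) div 2) + 1"
proof -
  have "pts M \<noteq> {}" using smooth_manifold unfolding smooth_manifold_def by blast
  then obtain p where "p \<in> pts M" by blast
  then obtain c where "c \<in> charts_at M p" using charts_at_ex by blast
  then interpret three_cosymplectic_chart M \<phi> \<xi> \<eta> g p c by (rule chart_locale)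
  show ?thesis using dim_odd by simp
qed

lemma almost_cosymplectic_comb:
  assumes l: "norm l = 1"
  shows "almost_cosymplectic (DIM('e) div 2) M (comb l \<eta>) (comb l \<Omega>)"
  unfolding almost_cosymplectic_def
proof (intro conjI ballI)
  show "smooth_manifold M" by (rule smooth_manifold)
  show "DIM('e) = 2 * (DIM('e) div 2) + 1" by (rule dim)
  show "one_form M (comb l \<eta>)" by (intro one_form_comb one_form_\<eta>)
  show "two_form M (comb l \<Omega>)" by (intro two_form_comb two_form_\<Omega>)
  fix p assume "p \<in> pts M"
  then obtain c where "c \<in> charts_at M p" using charts_at_ex by blast
  then interpret three_cosymplectic_chart M \<phi> \<xi> \<eta> g p c by (rule chart_locale)
  obtain b where b: "H.vol (DIM('e) div 2) l b > 0" using H.vol_basis[OF l dim] by blast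
  show "\<exists>v. (\<forall>i. v i \<in> T) \<and> eta_wedge_Omega (DIM('e) div 2) (comb l \<eta>) (comb l \<Omega>) p v \<noteq> 0"
    \<comment> \<open>A basis of the coordinate space with positive volume is carried to the tangent
      space by \<open>L\<close>.\<close>
    using b by (intro exI[of _ "\<lambda>i. L (b i)"]) (simp add: L_T eta_wedge_Omega_comb L_c)
qed

lemma cosymplectic_comb:
  "norm l = 1 \<Longrightarrow> cosymplectic (DIM('e) div 2) M (comb l \<eta>) (comb l \<Omega>)"
  by (simp add: cosymplectic_def almost_cosymplectic_comb closed1_comb closed2_comb one_form_\<eta>
      two_form_\<Omega> closed1_\<eta> closed2_\<Omega>)

lemma taut: "taut (DIM('e) div 2) M \<eta> \<Omega>"
  unfolding taut_def
proof (intro ballI allI impI)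
  fix l l' p and v :: "nat \<Rightarrow> ('a, 'e) tvec"
  assume l: "l \<in> S2" "l' \<in> S2" and p: "p \<in> pts M" and v: "\<forall>i. v i \<in> tangent_space M p"
  obtain c where "c \<in> charts_at M p" using charts_at_ex[OF p] by blast
  then interpret three_cosymplectic_chart M \<phi> \<xi> \<eta> g p c by (rule chart_locale)
  show "eta_wedge_Omega (DIM('e) div 2) (comb l \<eta>) (comb l \<Omega>) p v =
      eta_wedge_Omega (DIM('e) div 2) (comb l' \<eta>) (comb l' \<Omega>) p v"
    using v l H.vol_const[OF _ _ dim, of l l'] by (simp add: eta_wedge_Omega_comb)
qed

lemma is_reeb_comb:
  assumes l: "norm l = 1"
  shows "is_reeb M (comb l \<eta>) (comb l \<Omega>) (comb l \<xi>)"
proof -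
  have vf: "vector_field M (comb l \<xi>)" by (intro vector_field_comb vector_field_\<xi>)
  have pt: "comb l \<eta> p (comb l \<xi> p) = 1 \<and> (\<forall>v\<in>tangent_space M p. comb l \<Omega> p (comb l \<xi> p) v = 0) \<and>
      (\<forall>z\<in>tangent_space M p. comb l \<eta> p z = 1 \<longrightarrow>
        (\<forall>v\<in>tangent_space M p. comb l \<Omega> p z v = 0) \<longrightarrow> z = comb l \<xi> p)"
    if p: "p \<in> pts M" for p
  proof -
    obtain c where "c \<in> charts_at M p" using charts_at_ex[OF p] by blast
    then interpret three_cosymplectic_chart M \<phi> \<xi> \<eta> g p c by (rule chart_locale)
    show ?thesis using reeb_comb[OF l] by blast
  qed
  have "z = comb l \<xi>" if z: "reeb_conditions M (comb l \<eta>) (comb l \<Omega>) z" for z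
  proof
    fix p
    show "z p = comb l \<xi> p"
    proof (cases "p \<in> pts M")
      case True
      then have "z p \<in> tangent_space M p" "comb l \<eta> p (z p) = 1"
        "\<forall>v\<in>tangent_space M p. comb l \<Omega> p (z p) v = 0"
        using z unfolding reeb_conditions_def vector_field_def by blast+
      then show ?thesis using pt[OF True] by blast
    next
      \<comment> \<open>Vector fields are zero off the manifold by convention, so uniqueness holds
        as an equality of functions.\<close>
      case False
      then have "z p = 0" "comb l \<xi> p = 0"
        using z vf unfolding reeb_conditions_def vector_field_def by blast+
      then show ?thesis by simp
    qed
  qed
  moreover have "reeb_conditions M (comb l \<eta>) (comb l \<Omega>) (comb l \<xi>)"
    using vf pt unfolding reeb_conditions_def by blast
  ultimately show ?thesis unfolding is_reeb_def by blast
qed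

lemma round_sphere: "round_sphere M \<eta> \<Omega>"
  unfolding round_sphere_def
proof (intro exI conjI allI ballI)
  show "is_reeb M (\<eta> i) (\<Omega> i) (\<xi> i)" for i
    using is_reeb_comb[of "axis i 1"] by (simp add: comb_axis)
  show "is_reeb M (comb l \<eta>) (comb l \<Omega>) (comb l \<xi>)" if "l \<in> S2" for l
    using that by (intro is_reeb_comb) simp
qed

lemma almost_cosymplectic_sphere: "almost_cosymplectic_sphere (DIM('e) div 2) M \<eta> \<Omega>"
  unfolding almost_cosymplectic_sphere_def
proof (intro conjI allI ballI)
  show "almost_cosymplectic (DIM('e) div 2) M (\<eta> i) (\<Omega> i)" for i
    using almost_cosymplectic_comb[of "axis i 1"] by (simp add: comb_axis)
qed (simp add: almost_cosymplectic_comb)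

end

theorem corollary4p9:
  fixes M :: "('a, 'e::euclidean_space) manifold"
    and \<phi> :: "3 \<Rightarrow> ('a, 'e) tensor11"
    and \<xi> :: "3 \<Rightarrow> ('a, 'e) vfield"
    and \<eta> :: "3 \<Rightarrow> ('a, 'e) form1"
    and g :: "('a, 'e) tensor02"
  assumes "three_cosymplectic M \<phi> \<xi> \<eta> g"
  shows "\<exists>(m::nat) (\<eta>' :: 3 \<Rightarrow> ('a, 'e) form1) (\<Omega>' :: 3 \<Rightarrow> ('a, 'e) tensor02).
    almost_cosymplectic_sphere m M \<eta>' \<Omega>' \<and> taut m M \<eta>' \<Omega>' \<and> round_sphere M \<eta>' \<Omega>' \<and>
    (\<forall>l\<in>S2. cosymplectic m M (comb l \<eta>') (comb l \<Omega>'))"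
proof -
  interpret three_cosymplectic_mfd M \<phi> \<xi> \<eta> g
    using assms by unfold_locales (auto simp: three_cosymplectic_def)
  show ?thesis
    using almost_cosymplectic_sphere taut round_sphere cosymplectic_comb
    by (intro exI[of _ "DIM('e) div 2"] exI[of _ \<eta>] exI[of _ \<Omega>]) simp
qed

end
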